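(* There exist a universal constant $C_\star>0$ and, for each $d\in\{1,2,\dots\}$, an estimator $\hat\pi_\star$ (a family of functions, one for each trajectory length $m$, mapping $[d]^m$ to $\mathbb{R}$) such that for all $0<\varepsilon<1$ and $0<\delta<1$ the following holds. Let $(M,\mu)$ be any ergodic $d$-state Markov chain with minimum stationary probability $\pi_\star$ and pseudo-spectral gap $\gamma_{\mathsf{ps}}$, and let $X=(X_1,\dots,X_m)$ be drawn according to $(M,\mu)$, with $$m\ \ge\ m_{\mathrm{UB}} := \frac{C_\star}{\gamma_{\mathsf{ps}}\,\varepsilon^2\,\pi_\star}\,\ln\left(\frac{d}{\delta}\sqrt{\pi_\star^{-1}}\right).$$ Then $|\hat\pi_\star(X)-\pi_\star|<\varepsilon\,\pi_\star$ holds with probability at least $1-\delta$.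
   Context: $[d]=\{1,\dots,d\}$. A $d$-state Markov chain is a pair $(M,\mu)$ with $M$ a $d\times d$ row-stochastic matrix and $\mu$ a probability distribution on $[d]$; $(X_1,\dots,X_m)\sim(M,\mu)$ means $\mathbf{P}((X_1,\dots,X_m)=(x_1,\dots,x_m))=\mu(x_1)\prod_{t=1}^{m-1}M(x_t,x_{t+1})$. The chain is ergodic if $M^k$ is entry-wise positive for some $k\ge1$; it then has a unique stationary distribution $\pi$ (row vector with $\pi M=\pi$), and $\pi_\star=\min_{i\in[d]}\pi_i>0$ is its minimum stationary probability. The time reversal of $M$ is $M^\dagger(i,j)=\pi(j)M(j,i)/\pi(i)$. For a chain that is reversible with respect to $\pi$, with real eigenvalues $1=\lambda_1\ge\lambda_2\ge\dots\ge\lambda_d$ (with multiplicity), the spectral gap is $\gamma=1-\lambda_2$. The chain $(M^\dagger)^kM^k$ is always reversible, and the pseudo-spectral gap of $M$ is $\gamma_{\mathsf{ps}}=\max_{k\ge1}\frac{\gamma((M^\dagger)^kM^k)}{k}$. The estimator knows $d$ but not $M$ or $\mu$. *)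

theory Defs
  imports "HOL-Probability.Probability_Mass_Function" "Jordan_Normal_Form.Char_Poly"
begin

text \<open>
  The state space with \<open>d\<close> elements is \<open>{..<d}\<close>. Distributions on it are values of type
  \<open>nat pmf\<close> whose support is contained in \<open>{..<d}\<close>.
\<close>

definition row_stochastic :: "nat \<Rightarrow> real mat \<Rightarrow> bool" where
  "row_stochastic d M \<longleftrightarrow>
     M \<in> carrier_mat d d \<and>
     (\<forall>i<d. \<forall>j<d. 0 \<le> M $$ (i, j)) \<and>
     (\<forall>i<d. (\<Sum>j<d. M $$ (i, j)) = 1)"

definition markov_chain :: "nat \<Rightarrow> real mat \<Rightarrow> nat pmf \<Rightarrow> bool" where
  "markov_chain d M \<mu> \<longleftrightarrow> row_stochastic d M \<and> set_pmf \<mu> \<subseteq> {..<d}"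

definition ergodic :: "nat \<Rightarrow> real mat \<Rightarrow> bool" where
  "ergodic d M \<longleftrightarrow> (\<exists>k\<ge>1. \<forall>i<d. \<forall>j<d. 0 < (M ^\<^sub>m k) $$ (i, j))"

definition stationary :: "nat \<Rightarrow> real mat \<Rightarrow> nat pmf \<Rightarrow> bool" where
  "stationary d M \<pi> \<longleftrightarrow>
     set_pmf \<pi> \<subseteq> {..<d} \<and>
     (\<forall>j<d. (\<Sum>i<d. pmf \<pi> i * M $$ (i, j)) = pmf \<pi> j)"

definition min_prob :: "nat \<Rightarrow> nat pmf \<Rightarrow> real" where
  "min_prob d \<pi> = Min (pmf \<pi> ` {..<d})"

text \<open>
  \<open>trajectory_law d M \<mu> m P\<close> says that \<open>P\<close> is the law of \<open>(X\<^sub>1, \<dots>, X\<^sub>m) \<sim> (M, \<mu>)\<close>. Only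
  \<open>m \<ge> 1\<close> is meaningful. The prescribed values then sum to one, so \<open>P\<close> is uniquely determined
  and vanishes off the lists of length \<open>m\<close> over \<open>{..<d}\<close>. List positions start at 0.
\<close>

definition trajectory_law ::
  "nat \<Rightarrow> real mat \<Rightarrow> nat pmf \<Rightarrow> nat \<Rightarrow> nat list pmf \<Rightarrow> bool" where
  "trajectory_law d M \<mu> m P \<longleftrightarrow>
     (\<forall>xs. length xs = m \<and> set xs \<subseteq> {..<d} \<longrightarrow>
        pmf P xs = pmf \<mu> (xs ! 0) * (\<Prod>t<m - 1. M $$ (xs ! t, xs ! Suc t)))"

definition time_reversal :: "nat \<Rightarrow> nat pmf \<Rightarrow> real mat \<Rightarrow> real mat" where
  "time_reversal d \<pi> M = mat d d (\<lambda>(i, j). pmf \<pi> j * M $$ (j, i) / pmf \<pi> i)"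

definition real_eigenvalues :: "real mat \<Rightarrow> real list" where
  "real_eigenvalues A = rev (sorted_list_of_multiset (proots (char_poly A)))"

text \<open>
  Intended for reversible chains, whose characteristic polynomial splits over the reals, so that
  the list of eigenvalues has length \<open>d\<close> and \<open>\<lambda>\<^sub>2\<close> is its entry at position 1. A one-state chain
  has no second eigenvalue; its gap is taken to be 1.
\<close>

definition spectral_gap :: "real mat \<Rightarrow> real" where
  "spectral_gap A = (if dim_row A = 1 then 1 else 1 - real_eigenvalues A ! 1)"

text \<open>
  For an ergodic chain the greatest element exists: the gaps lie in \<open>[0, 1]\<close> and are positive for
  some \<open>k\<close>, while the quotients by \<open>k\<close> tend to 0.
\<close>

definition pseudo_spectral_gap :: "nat \<Rightarrow> nat pmf \<Rightarrow> real mat \<Rightarrow> real" where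
  "pseudo_spectral_gap d \<pi> M =
     (GREATEST x. \<exists>k\<ge>1. x = spectral_gap ((time_reversal d \<pi> M ^\<^sub>m k) * (M ^\<^sub>m k)) / real k)"

end

theory Submission
  imports Defs "Jordan_Normal_Form.Schur_Decomposition"
begin

text \<open>
  The estimator is the smallest empirical frequency, \<open>min\<^sub>i N\<^sub>i / m\<close>, where \<open>N\<^sub>i\<close> counts the visits
  to state \<open>i\<close> (a single state has \<open>\<pi>\<^sub>\<star> = 1\<close>). If every \<open>N\<^sub>i / m\<close> exceeds \<open>(1 - \<epsilon>) \<pi>(i)\<close> and, at one minimizer of \<open>\<pi>\<close>,
  \<open>N\<^sub>i / m\<close> is below \<open>(1 + \<epsilon>) \<pi>(i)\<close>, then the minimum is accurate to relative error \<open>\<epsilon>\<close>. So the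
  whole matter is a multiplicative Chernoff bound for the number of visits to one state, with
  failure probability exponentially small in \<open>m \<gamma>\<^sub>p\<^sub>s \<epsilon>\<^sup>2 \<pi>(i)\<close> (\<open>occupation_tail\<close>). The exponent is
  linear in \<open>\<pi>(i)\<close> because the centred indicator of \<open>i\<close> has variance at most \<open>\<pi>(i)\<close>.

  The pseudo-spectral gap enters through a lag \<open>k\<close> at which its maximum is attained
  (\<open>pseudo_spectral_gap_attained\<close>). Put \<open>Q = M\<^sup>k\<close> and \<open>g = k \<gamma>\<^sub>p\<^sub>s\<close>. The variational description of the
  second eigenvalue of \<open>Q\<^sup>\<dagger> Q\<close> says that \<open>Q\<close> shrinks the squared norm in \<open>L\<^sup>2(\<pi>)\<close> of mean-zero
  functions by the factor \<open>1 - g\<close>. To use the eigenvalues as roots of the characteristic polynomial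
  one needs an orthogonal eigenbasis of \<open>Q\<^sup>\<dagger> Q\<close>, which is obtained from a Schur decomposition by
  Gram-Schmidt (\<open>reversible_eigenbasis\<close>).

  Let \<open>H\<close> be multiplication by \<open>y\<close> at the state \<open>i\<close>, where \<open>y\<^sup>2 = 1 + u\<close>. The contraction implies
  that the squared norm of \<open>Q H\<close> is at most the largest eigenvalue of \<open>H R H\<close>, where the chain \<open>R\<close>
  jumps to \<open>\<pi>\<close> with probability \<open>g\<close> and otherwise stays; as \<open>H\<close> distinguishes only \<open>i\<close> from its
  complement, this is an eigenvalue of a two by two matrix, and it is at most
  \<open>1 + \<pi>(i) (u + 2 u\<^sup>2 / g)\<close> when \<open>\<bar>u\<bar> \<le> g / 2\<close> (\<open>two_state_inequality\<close>,
  \<open>tilted_kernel_norm\<close>).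

  Split the time axis into the \<open>k\<close> residue classes modulo \<open>k\<close>. Along one class the stationary chain
  is a chain with kernel \<open>Q\<close>, so the expectation of \<open>y\<close> to the power of the number of visits in that
  class is a power of \<open>Q H\<close> tested against constants, hence bounded by a power of its norm
  (\<open>sampled_expectation\<close>). Convexity of the exponential recombines the classes into an
  exponential moment of \<open>N\<^sub>i\<close> (\<open>occupation_mgf\<close>), and Markov's inequality with
  \<open>\<bar>u\<bar> = \<epsilon> g / 8\<close> gives both tails. Passing from the stationary start to an arbitrary one costs at
  most a factor \<open>1 / \<pi>\<^sub>\<star>\<close>, and a union bound over \<open>d + 1\<close> events costs another factor \<open>d + 1\<close>; both
  are absorbed by the logarithm in the hypothesis.
\<close>

section \<open>Matrices acting on functions\<close>

definition app :: "nat \<Rightarrow> real mat \<Rightarrow> (nat \<Rightarrow> real) \<Rightarrow> nat \<Rightarrow> real" where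
  "app d A f i = (\<Sum>j<d. A $$ (i, j) * f j)"

lemma app_cong: "(\<And>j. j < d \<Longrightarrow> f j = g j) \<Longrightarrow> app d A f i = app d A g i"
  by (simp add: app_def)

lemma app_sum: "app d A (\<lambda>x. \<Sum>k\<in>K. c k * u k x) i = (\<Sum>k\<in>K. c k * app d A (u k) i)"
  unfolding app_def sum_distrib_left
  by (subst sum.swap) (simp add: algebra_simps)

lemma app_diff: "app d A (\<lambda>x. f x - g x) i = app d A f i - app d A g i"
  by (simp add: app_def algebra_simps sum_subtractf)

lemma mult_entry:
  assumes "A \<in> carrier_mat d d" "B \<in> carrier_mat d d" "i < d" "j < d"
  shows "(A * B) $$ (i, j) = (\<Sum>k<d. A $$ (i, k) * B $$ (k, j))"
  using assms by (simp add: scalar_prod_def atLeast0LessThan)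

lemma app_mult:
  assumes "A \<in> carrier_mat d d" "B \<in> carrier_mat d d" "i < d"
  shows "app d (A * B) f i = app d A (app d B f) i"
proof -
  have "app d (A * B) f i = (\<Sum>j<d. \<Sum>k<d. A $$ (i, k) * B $$ (k, j) * f j)"
    unfolding app_def using assms
    by (intro sum.cong refl) (simp add: mult_entry sum_distrib_right del: index_mult_mat)
  also have "\<dots> = app d A (app d B f) i"
    unfolding app_def sum_distrib_left by (subst sum.swap) (simp add: mult.assoc)
  finally show ?thesis .
qed

lemma app_one: "i < d \<Longrightarrow> app d (1\<^sub>m d) f i = f i"
  by (simp add: app_def if_distrib[of "\<lambda>x. x * _"] cong: if_cong)

section \<open>Reversible matrices and their eigenbases\<close>

locale weighted_space =
  fixes d :: nat and p :: "nat \<Rightarrow> real"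
  assumes p_pos: "i < d \<Longrightarrow> 0 < p i"
begin

definition ip :: "(nat \<Rightarrow> real) \<Rightarrow> (nat \<Rightarrow> real) \<Rightarrow> real" where
  "ip f g = (\<Sum>i<d. p i * f i * g i)"

definition reversible :: "real mat \<Rightarrow> bool" where
  "reversible A \<longleftrightarrow> A \<in> carrier_mat d d \<and> (\<forall>i<d. \<forall>j<d. p i * A $$ (i, j) = p j * A $$ (j, i))"

lemma ip_commute: "ip f g = ip g f"
  by (simp add: ip_def mult_ac)

lemma ip_cong: "(\<And>i. i < d \<Longrightarrow> f i = f' i) \<Longrightarrow> (\<And>i. i < d \<Longrightarrow> g i = g' i) \<Longrightarrow> ip f g = ip f' g'"
  by (simp add: ip_def)

lemma ip_sum: "ip (\<lambda>x. \<Sum>k\<in>K. c k * u k x) g = (\<Sum>k\<in>K. c k * ip (u k) g)"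
  unfolding ip_def sum_distrib_left sum_distrib_right
  by (subst sum.swap) (simp add: algebra_simps)

lemma ip_diff: "ip (\<lambda>x. f x - h x) g = ip f g - ip h g"
  by (simp add: ip_def algebra_simps sum_subtractf)

lemma ip_scale: "ip (\<lambda>x. c * f x) g = c * ip f g"
  by (simp add: ip_def algebra_simps sum_distrib_left)

lemma ip_add: "ip (\<lambda>x. f x + h x) g = ip f g + ip h g"
  by (simp add: ip_def algebra_simps sum.distrib)

lemma ip_self_nonneg: "0 \<le> ip f f"
  unfolding ip_def using p_pos by (intro sum_nonneg) (auto simp: mult.assoc less_imp_le)

lemma ip_self_eq_0: "ip f f = 0 \<longleftrightarrow> (\<forall>i<d. f i = 0)"
proof -
  have "ip f f = 0 \<longleftrightarrow> (\<forall>i\<in>{..<d}. p i * f i * f i = 0)"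
    unfolding ip_def using p_pos
    by (intro sum_nonneg_eq_0_iff) (auto simp: mult.assoc less_imp_le)
  then show ?thesis using p_pos by (metis lessThan_iff less_irrefl mult_eq_0_iff)
qed

lemma ip_app_commute:
  assumes "reversible A"
  shows "ip (app d A f) g = ip f (app d A g)"
proof -
  have "ip (app d A f) g = (\<Sum>i<d. \<Sum>j<d. (p i * A $$ (i, j)) * f j * g i)"
    by (simp add: ip_def app_def sum_distrib_left sum_distrib_right mult_ac)
  also have "\<dots> = (\<Sum>i<d. \<Sum>j<d. (p j * A $$ (j, i)) * f j * g i)"
    using assms by (intro sum.cong refl) (auto simp: reversible_def)
  also have "\<dots> = ip f (app d A g)"
    unfolding ip_def app_def sum_distrib_left
    by (subst sum.swap) (simp add: mult_ac)
  finally show ?thesis .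
qed

text \<open>
  For an eigenvector \<open>v\<close> of \<open>a\<close>, the weighted Hermitian form of \<open>A\<close> at \<open>v\<close> is \<open>a\<close> times the
  squared weighted norm of \<open>v\<close>, and detailed balance makes this form equal to its own conjugate.
\<close>

lemma reversible_complex_eigenvalue_real:
  assumes A: "reversible A" and ev: "eigenvalue (map_mat complex_of_real A) a"
  shows "a \<in> \<real>"
proof -
  let ?A = "map_mat complex_of_real A"
  have Ac: "A \<in> carrier_mat d d" using A by (simp add: reversible_def)
  then have dim[simp]: "dim_row A = d" "dim_col A = d" by auto
  obtain v where v: "v \<in> carrier_vec d" "v \<noteq> 0\<^sub>v d" "?A *\<^sub>v v = a \<cdot>\<^sub>v v"
    using ev unfolding eigenvalue_def eigenvector_def by auto
  have row: "(\<Sum>j<d. complex_of_real (A $$ (i, j)) * v $ j) = a * v $ i" if "i < d" for i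
  proof -
    have "(?A *\<^sub>v v) $ i = a * v $ i" using v that by simp
    then show ?thesis using that v(1) by (simp add: scalar_prod_def atLeast0LessThan)
  qed
  define S where "S = (\<Sum>i<d. \<Sum>j<d. complex_of_real (p i * A $$ (i, j)) * cnj (v $ i) * v $ j)"
  define N where "N = (\<Sum>i<d. p i * (cmod (v $ i))\<^sup>2)"
  have S: "S = a * complex_of_real N"
  proof -
    have "S = (\<Sum>i<d. complex_of_real (p i) * cnj (v $ i) * (a * v $ i))"
      unfolding S_def
      by (intro sum.cong refl, subst row[symmetric]) (auto simp: sum_distrib_left mult_ac)
    also have "\<dots> = (\<Sum>i<d. a * complex_of_real (p i * (cmod (v $ i))\<^sup>2))"
      by (intro sum.cong refl) (simp add: complex_norm_square mult_ac del: of_real_power)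
    finally show ?thesis by (simp add: N_def sum_distrib_left)
  qed
  have "cnj S = (\<Sum>i<d. \<Sum>j<d. complex_of_real (p j * A $$ (j, i)) * v $ i * cnj (v $ j))"
    using A unfolding S_def by (auto simp: reversible_def intro!: sum.cong)
  also have "\<dots> = S" unfolding S_def
    by (subst sum.swap) (simp add: mult_ac)
  finally have "cnj a * complex_of_real N = a * complex_of_real N"
    using S by simp
  moreover have "N > 0"
  proof -
    obtain i where "i < d" "v $ i \<noteq> 0" using v(1,2) by (metis carrier_vecD eq_vecI index_zero_vec)
    then have "0 < p i * (cmod (v $ i))\<^sup>2" using p_pos by simp
    also have "\<dots> \<le> N" unfolding N_def using \<open>i < d\<close> p_pos
      by (intro member_le_sum) (auto simp: less_imp_le)
    finally show ?thesis .
  qed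
  ultimately show ?thesis by (simp add: complex_is_Real_iff complex_eq_iff)
qed

lemma reversible_char_poly_splits:
  assumes A: "reversible A"
  obtains es where "char_poly A = (\<Prod>e\<leftarrow>es. [:- e, 1:])" "length es = d"
proof -
  let ?A = "map_mat complex_of_real A"
  have Ac: "A \<in> carrier_mat d d" using A by (simp add: reversible_def)
  then have cA: "?A \<in> carrier_mat d d" by simp
  from char_poly_factorized[OF this] obtain as where
    as: "char_poly ?A = (\<Prod>a\<leftarrow>as. [:- a, 1:])" "length as = d" by auto
  have real: "a \<in> \<real>" if "a \<in> set as" for a
  proof -
    have "poly (char_poly ?A) a = 0"
      using that unfolding as poly_prod_list prod_list_zero_iff by force
    then show ?thesis using reversible_complex_eigenvalue_real[OF A]
      eigenvalue_root_char_poly[OF cA] by blast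
  qed
  define es where "es = map Re as"
  have as_es: "as = map complex_of_real es"
    using real by (simp add: es_def map_idI)
  interpret h: inj_comm_ring_hom complex_of_real by unfold_locales auto
  interpret ph: map_poly_inj_comm_ring_hom complex_of_real ..
  have "map_poly complex_of_real (char_poly A) = char_poly ?A"
    by (rule of_real_hom.char_poly_hom[OF Ac, symmetric])
  also have "\<dots> = map_poly complex_of_real (\<Prod>e\<leftarrow>es. [:- e, 1:])"
    unfolding as as_es by (simp add: ph.hom_prod_list o_def)
  finally have "char_poly A = (\<Prod>e\<leftarrow>es. [:- e, 1:])" by simp
  moreover have "length es = d" by (simp add: es_def as)
  ultimately show ?thesis using that by blast
qed

end

lemma proots_linear_factors: "proots (\<Prod>e\<leftarrow>es. [:- e, 1:]) = mset es"
  for es :: "real list"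
proof (induction es)
  case (Cons e es)
  have "(\<Prod>e\<leftarrow>es. [:- e, 1:]) \<noteq> 0" by (auto simp: prod_list_zero_iff)
  then show ?case using Cons by (simp add: proots_mult del: mult_pCons_left)
qed simp

text \<open>
  Functions matter only at arguments below \<open>d\<close>, so the equality with a linear combination is
  required only there.
\<close>

definition in_span :: "nat \<Rightarrow> (nat \<Rightarrow> nat \<Rightarrow> real) \<Rightarrow> nat \<Rightarrow> (nat \<Rightarrow> real) \<Rightarrow> bool" where
  "in_span d u n f \<longleftrightarrow> (\<exists>c. \<forall>x<d. f x = (\<Sum>k<n. c k * u k x))"

lemma in_span_base:
  assumes "k < n" shows "in_span d u n (u k)"
  unfolding in_span_def using assms
  by (intro exI[of _ "\<lambda>i. if i = k then 1 else 0"]) (simp add: if_distrib[of "\<lambda>x. x * _"] cong: if_cong)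

lemma in_span_scale:
  assumes "in_span d u n f" shows "in_span d u n (\<lambda>x. a * f x)"
proof -
  obtain c where "\<forall>x<d. f x = (\<Sum>k<n. c k * u k x)" using assms by (auto simp: in_span_def)
  then show ?thesis unfolding in_span_def
    by (intro exI[of _ "\<lambda>k. a * c k"]) (simp add: sum_distrib_left mult.assoc)
qed

lemma in_span_diff:
  assumes "in_span d u n f" "in_span d u n g" shows "in_span d u n (\<lambda>x. f x - g x)"
proof -
  obtain c c' where "\<forall>x<d. f x = (\<Sum>k<n. c k * u k x)" "\<forall>x<d. g x = (\<Sum>k<n. c' k * u k x)"
    using assms by (auto simp: in_span_def)
  then show ?thesis unfolding in_span_def
    by (intro exI[of _ "\<lambda>k. c k - c' k"]) (simp add: left_diff_distrib sum_subtractf)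
qed

lemma in_span_sum:
  assumes "\<And>k. k \<in> K \<Longrightarrow> in_span d u n (f k)"
  shows "in_span d u n (\<lambda>x. \<Sum>k\<in>K. f k x)"
proof -
  obtain c where c: "\<forall>k\<in>K. \<forall>x<d. f k x = (\<Sum>i<n. c k i * u i x)"
    using assms unfolding in_span_def by metis
  show ?thesis unfolding in_span_def
  proof (intro exI[of _ "\<lambda>i. \<Sum>k\<in>K. c k i"] allI impI)
    fix x assume "x < d"
    then have "(\<Sum>k\<in>K. f k x) = (\<Sum>k\<in>K. \<Sum>i<n. c k i * u i x)" using c by simp
    then show "(\<Sum>k\<in>K. f k x) = (\<Sum>i<n. (\<Sum>k\<in>K. c k i) * u i x)"
      unfolding sum_distrib_right by (subst sum.swap) simp
  qed
qed

lemma in_span_mono: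
  assumes "in_span d u n f" "n \<le> m" shows "in_span d u m f"
proof -
  obtain c where c: "\<forall>x<d. f x = (\<Sum>k<n. c k * u k x)" using assms by (auto simp: in_span_def)
  have "(\<Sum>k<n. c k * u k x) = (\<Sum>k<m. (if k < n then c k else 0) * u k x)" for x
    using \<open>n \<le> m\<close> by (intro sum.mono_neutral_cong_left) auto
  then show ?thesis unfolding in_span_def using c by metis
qed

lemma in_span_cong:
  assumes "in_span d u n f" "\<And>x. x < d \<Longrightarrow> f x = g x" "\<And>k. k < n \<Longrightarrow> u k = u' k"
  shows "in_span d u' n g"
  using assms unfolding in_span_def by simp

context weighted_space
begin

text \<open>
  The columns of the transition matrix of a Schur decomposition form a flag: \<open>A\<close> maps the \<open>j\<close>-th
  column to \<open>es ! j\<close> times itself plus a combination of the earlier ones. Orthogonalizing the columns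
  in order for the weighted inner product turns them into eigenvectors, since by self-adjointness the
  combination of earlier vectors that remains is orthogonal to all of them and therefore vanishes.
  The eigenvectors come in the order of the given list \<open>es\<close>, which may be chosen sorted.
\<close>

lemma reversible_eigenbasis:
  assumes A: "reversible A" and es: "char_poly A = (\<Prod>e\<leftarrow>es. [:- e, 1:])"
  obtains u where "\<And>j i. j < d \<Longrightarrow> i < d \<Longrightarrow> app d A (u j) i = es ! j * u j i"
    and "\<And>j. j < d \<Longrightarrow> 0 < ip (u j) (u j)"
    and "\<And>j k. j < d \<Longrightarrow> k < d \<Longrightarrow> j \<noteq> k \<Longrightarrow> ip (u j) (u k) = 0"
    and "\<And>f x. x < d \<Longrightarrow> f x = (\<Sum>j<d. ip f (u j) / ip (u j) (u j) * u j x)"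
proof -
  have Ac: "A \<in> carrier_mat d d" using A by (simp add: reversible_def)
  obtain B P Q where "schur_decomposition A es = (B, P, Q)" by (metis prod_cases3)
  from schur_decomposition[OF Ac es this]
  have sim: "similar_mat_wit A B P Q" and up: "upper_triangular B" and diag: "diag_mat B = es" by auto
  note PQ = similar_mat_witD2[OF Ac sim]
  define pc where "pc = (\<lambda>j x. P $$ (x, j))"
  have Bdiag: "B $$ (n, n) = es ! n" if "n < d" for n
    using diag that PQ(5) by (auto simp: diag_mat_def)
  have app_pc: "app d A (pc j) i = (\<Sum>k<j. B $$ (k, j) * pc k i) + es ! j * pc j i"
    if "j < d" "i < d" for j i
  proof -
    have "A * P = P * B * (Q * P)"
      unfolding PQ(3) using PQ(4-7) by (simp add: assoc_mult_mat[of _ d d _ d _ d])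
    also have "\<dots> = P * B" using PQ by simp
    finally have "(A * P) $$ (i, j) = (P * B) $$ (i, j)" by simp
    then have "app d A (pc j) i = (\<Sum>k<d. P $$ (i, k) * B $$ (k, j))"
      using that unfolding mult_entry[OF Ac PQ(6) that(2,1)] mult_entry[OF PQ(6,5) that(2,1)]
      by (simp add: app_def pc_def)
    also have "\<dots> = (\<Sum>k<Suc j. P $$ (i, k) * B $$ (k, j))"
      using that up PQ(5) by (intro sum.mono_neutral_right) (auto simp: upper_triangular_def)
    finally show ?thesis using Bdiag[OF that(1)] by (simp add: pc_def mult.commute)
  qed
  have expand_pc: "f x = (\<Sum>j<d. app d Q f j * pc j x)" if "x < d" for f x
  proof -
    have "f x = app d (P * Q) f x" using PQ(1) that by (simp add: app_one)
    also have "\<dots> = app d P (app d Q f) x" by (rule app_mult[OF PQ(6,7) that])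
    finally show ?thesis by (simp add: app_def[of d P] pc_def mult.commute)
  qed
  have Q_pc: "app d Q (pc j) i = (if i = j then 1 else 0)" if "j < d" "i < d" for i j
  proof -
    have "(Q * P) $$ (i, j) = (if i = j then 1 else 0)" using PQ(2) that by simp
    then show ?thesis unfolding mult_entry[OF PQ(7,6) that(2,1)] by (simp add: app_def pc_def)
  qed
  have ip_pos: "0 < ip f f" if "j < d" "app d Q f j \<noteq> 0" for f j
  proof (rule ccontr)
    assume "\<not> ?thesis"
    then have "\<forall>i<d. f i = 0" using ip_self_nonneg[of f] ip_self_eq_0[of f] by simp
    then show False using that by (simp add: app_def)
  qed
  \<comment> \<open>The condition on \<open>app d Q (u j)\<close> (coordinates in the columns of \<open>P\<close>) keeps \<open>u j\<close> from being zero.\<close>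
  define flag where "flag n u \<longleftrightarrow>
      (\<forall>j<n. (\<forall>i<d. app d A (u j) i = es ! j * u j i) \<and>
             app d Q (u j) j = 1 \<and> (\<forall>i<d. j < i \<longrightarrow> app d Q (u j) i = 0) \<and>
             in_span d u (Suc j) (pc j)) \<and>
      (\<forall>j<n. \<forall>k<n. j \<noteq> k \<longrightarrow> ip (u j) (u k) = 0)" for n u
  have "\<exists>u. flag n u" if "n \<le> d" for n
    using that
  proof (induction n)
    case (Suc n)
    then obtain u where "flag n u" by auto
    then have
      eig: "\<And>j i. j < n \<Longrightarrow> i < d \<Longrightarrow> app d A (u j) i = es ! j * u j i" and
      Q1: "\<And>j. j < n \<Longrightarrow> app d Q (u j) j = 1" and
      Q0: "\<And>j i. j < n \<Longrightarrow> i < d \<Longrightarrow> j < i \<Longrightarrow> app d Q (u j) i = 0" and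
      sp: "\<And>j. j < n \<Longrightarrow> in_span d u (Suc j) (pc j)" and
      orth: "\<And>j k. j < n \<Longrightarrow> k < n \<Longrightarrow> j \<noteq> k \<Longrightarrow> ip (u j) (u k) = 0"
      by (auto simp: flag_def)
    have n: "n < d" using Suc by simp
    have pos: "0 < ip (u j) (u j)" if "j < n" for j
      using ip_pos[of j "u j"] Q1[OF that] that n by simp
    define c where "c k = ip (pc n) (u k) / ip (u k) (u k)" for k
    define w where "w = (\<lambda>x. pc n x - (\<Sum>k<n. c k * u k x))"
    have w_orth: "ip w (u k) = 0" if "k < n" for k
    proof -
      have "ip w (u k) = ip (pc n) (u k) - (\<Sum>i<n. c i * ip (u i) (u k))"
        unfolding w_def by (simp add: ip_diff ip_sum)
      also have "(\<Sum>i<n. c i * ip (u i) (u k)) = (\<Sum>i<n. if i = k then c k * ip (u k) (u k) else 0)"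
        using orth that by (intro sum.cong) auto
      also have "\<dots> = ip (pc n) (u k)" using that pos[OF that] by (simp add: c_def)
      finally show ?thesis by simp
    qed
    have Qw: "app d Q w i = (if i = n then 1 else 0)" if "i < d" "n \<le> i" for i
      unfolding w_def app_diff app_sum using Q_pc[OF n that(1)] Q0 that by simp
    \<comment> \<open>The defect of \<open>w\<close> as an eigenvector lies in the span of the earlier vectors and is orthogonal to it.\<close>
    define r where "r = (\<lambda>x. app d A w x - es ! n * w x)"
    have r_span: "in_span d u n r"
    proof (rule in_span_cong[where u = u])
      show "in_span d u n (\<lambda>x. (\<Sum>k<n. B $$ (k, n) * pc k x) -
          ((\<Sum>k<n. c k * (es ! k * u k x)) - es ! n * (\<Sum>k<n. c k * u k x)))"
        using in_span_mono[OF sp] by (intro in_span_diff in_span_scale in_span_sum in_span_base) auto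
      show "(\<Sum>k<n. B $$ (k, n) * pc k x) -
          ((\<Sum>k<n. c k * (es ! k * u k x)) - es ! n * (\<Sum>k<n. c k * u k x)) = r x" if "x < d" for x
        unfolding r_def w_def app_diff app_sum app_pc[OF n that]
        using eig that by (simp add: algebra_simps)
    qed auto
    have r_orth: "ip r (u k) = 0" if "k < n" for k
    proof -
      have "ip (app d A w) (u k) = ip w (app d A (u k))" by (rule ip_app_commute[OF A])
      also have "\<dots> = ip w (\<lambda>x. es ! k * u k x)" using eig that by (intro ip_cong) auto
      also have "\<dots> = 0" using w_orth[OF that] ip_scale[of "es ! k" "u k" w] by (simp add: ip_commute)
      finally show ?thesis unfolding r_def using w_orth[OF that] by (simp add: ip_diff ip_scale)
    qed
    have r0: "r x = 0" if "x < d" for x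
    proof -
      obtain a where a: "\<forall>x<d. r x = (\<Sum>k<n. a k * u k x)" using r_span by (auto simp: in_span_def)
      have "ip r r = ip (\<lambda>x. \<Sum>k<n. a k * u k x) r" using a by (intro ip_cong) auto
      also have "\<dots> = 0" unfolding ip_sum using r_orth by (simp add: ip_commute[of _ r])
      finally show ?thesis using ip_self_eq_0 that by simp
    qed
    define u' where "u' = u(n := w)"
    have u'_old: "u' j = u j" if "j < n" for j using that by (simp add: u'_def)
    have u'_new: "u' n = w" by (simp add: u'_def)
    have sp': "in_span d u' (Suc j) (pc j)" if "j < n" for j
      using in_span_cong[OF sp[OF that], of "pc j" u'] u'_old that by simp
    have sp_new: "in_span d u' (Suc n) (pc n)"
      unfolding in_span_def
      by (intro exI[of _ "\<lambda>k. if k = n then 1 else c k"]) (simp add: u'_def w_def)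
    have "flag (Suc n) u'"
      unfolding flag_def
    proof (intro conjI allI impI)
      fix j i assume ji: "j < Suc n" "i < d"
      show "app d A (u' j) i = es ! j * u' j i"
        using ji eig r0[OF ji(2)] by (cases "j = n") (auto simp: u'_old u'_new r_def)
      show "app d Q (u' j) i = 0" if "j < i"
        using ji Q0 Qw that by (cases "j = n") (auto simp: u'_old u'_new)
    next
      fix j assume "j < Suc n"
      then show "app d Q (u' j) j = 1"
        using Q1 Qw n by (cases "j = n") (auto simp: u'_old u'_new)
      show "in_span d u' (Suc j) (pc j)"
        using \<open>j < Suc n\<close> sp' sp_new by (cases "j = n") auto
    next
      fix j k assume "j < Suc n" "k < Suc n" "j \<noteq> k"
      then show "ip (u' j) (u' k) = 0"
        using orth w_orth ip_commute[of w] by (cases "j = n"; cases "k = n") (auto simp: u'_old u'_new)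
    qed
    then show ?case by blast
  qed (auto simp: flag_def[abs_def])
  from this[of d] obtain u where "flag d u" by auto
  then have
    eig: "\<And>j i. j < d \<Longrightarrow> i < d \<Longrightarrow> app d A (u j) i = es ! j * u j i" and
    Q1: "\<And>j. j < d \<Longrightarrow> app d Q (u j) j = 1" and
    sp: "\<And>j. j < d \<Longrightarrow> in_span d u (Suc j) (pc j)" and
    orth: "\<And>j k. j < d \<Longrightarrow> k < d \<Longrightarrow> j \<noteq> k \<Longrightarrow> ip (u j) (u k) = 0"
    by (auto simp: flag_def)
  have pos: "0 < ip (u j) (u j)" if "j < d" for j
    using ip_pos[of j "u j"] Q1[OF that] that by simp
  have expand: "f x = (\<Sum>j<d. ip f (u j) / ip (u j) (u j) * u j x)" if "x < d" for f x
  proof -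
    have "in_span d u d (\<lambda>x. \<Sum>j<d. app d Q f j * pc j x)"
      using in_span_mono[OF sp] by (intro in_span_scale in_span_sum) auto
    then have "in_span d u d f" by (rule in_span_cong) (rule expand_pc[symmetric], simp_all)
    then obtain c where c: "\<forall>x<d. f x = (\<Sum>k<d. c k * u k x)" by (auto simp: in_span_def)
    have "ip f (u j) = c j * ip (u j) (u j)" if "j < d" for j
    proof -
      have "ip f (u j) = ip (\<lambda>x. \<Sum>k<d. c k * u k x) (u j)" using c by (intro ip_cong) auto
      also have "\<dots> = (\<Sum>k<d. if k = j then c j * ip (u j) (u j) else 0)"
        unfolding ip_sum using orth that by (intro sum.cong) auto
      finally show ?thesis using that by simp
    qed
    then have "c j = ip f (u j) / ip (u j) (u j)" if "j < d" for j
      using pos[OF that] that by (simp add: field_simps)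
    then show ?thesis using c that by simp
  qed
  show ?thesis by (rule that[OF eig pos orth expand])
qed

lemma ip_eigen_expansion:
  assumes "\<And>j i. j < d \<Longrightarrow> i < d \<Longrightarrow> app d A (u j) i = es ! j * u j i"
    and "\<And>j. j < d \<Longrightarrow> 0 < ip (u j) (u j)"
    and "\<And>f x. x < d \<Longrightarrow> f x = (\<Sum>j<d. ip f (u j) / ip (u j) (u j) * u j x)"
  shows "ip f (app d A f) = (\<Sum>j<d. es ! j * ((ip f (u j))\<^sup>2 / ip (u j) (u j)))"
    and "ip f f = (\<Sum>j<d. (ip f (u j))\<^sup>2 / ip (u j) (u j))"
proof -
  have fexp: "ip f g = (\<Sum>j<d. ip f (u j) / ip (u j) (u j) * ip (u j) g)" for g
    unfolding ip_sum[symmetric] by (intro ip_cong assms(3)) auto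
  show "ip f f = (\<Sum>j<d. (ip f (u j))\<^sup>2 / ip (u j) (u j))"
    by (subst fexp) (simp add: ip_commute[of "u _" f] power2_eq_square)
  have "ip f (app d A f) = ip (app d A f) f" by (rule ip_commute)
  also have "\<dots> = ip (app d A (\<lambda>x. \<Sum>j<d. ip f (u j) / ip (u j) (u j) * u j x)) f"
    by (intro ip_cong app_cong assms(3)) auto
  also have "\<dots> = ip (\<lambda>x. \<Sum>j<d. ip f (u j) / ip (u j) (u j) * app d A (u j) x) f"
    by (intro ip_cong) (simp_all only: app_sum)
  also have "\<dots> = (\<Sum>j<d. ip f (u j) / ip (u j) (u j) * ip (app d A (u j)) f)"
    by (rule ip_sum)
  also have "\<dots> = (\<Sum>j<d. ip f (u j) / ip (u j) (u j) * ip (\<lambda>x. es ! j * u j x) f)"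
    using assms(1) by (intro sum.cong refl arg_cong2[where f="(*)"] ip_cong) auto
  finally show "ip f (app d A f) = (\<Sum>j<d. es ! j * ((ip f (u j))\<^sup>2 / ip (u j) (u j)))"
    by (simp add: ip_scale ip_commute[of "u _" f] power2_eq_square mult_ac)
qed

end

section \<open>Stationary kernels and spectral gaps\<close>

locale prob_weights = weighted_space +
  assumes p_sum: "(\<Sum>i<d. p i) = 1"
begin

definition kernel :: "real mat \<Rightarrow> bool" where
  "kernel Q \<longleftrightarrow> row_stochastic d Q \<and> (\<forall>j<d. (\<Sum>i<d. p i * Q $$ (i, j)) = p j)"

lemma kernel_carrier: "kernel Q \<Longrightarrow> Q \<in> carrier_mat d d"
  by (simp add: kernel_def row_stochastic_def)

lemma kernel_nonneg: "kernel Q \<Longrightarrow> i < d \<Longrightarrow> j < d \<Longrightarrow> 0 \<le> Q $$ (i, j)"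
  by (simp add: kernel_def row_stochastic_def)

lemma kernel_app_const: "kernel Q \<Longrightarrow> i < d \<Longrightarrow> app d Q (\<lambda>_. c) i = c"
  by (simp add: kernel_def row_stochastic_def app_def sum_distrib_right[symmetric])

lemma kernel_ip_one: 
  assumes "kernel Q" shows "ip (app d Q f) (\<lambda>_. 1) = ip f (\<lambda>_. 1)"
proof -
  have "ip (app d Q f) (\<lambda>_. 1) = (\<Sum>j<d. (\<Sum>i<d. p i * Q $$ (i, j)) * f j)"
    unfolding ip_def app_def sum_distrib_left sum_distrib_right
    by (subst sum.swap) (simp add: mult_ac)
  then show ?thesis using assms by (simp add: kernel_def ip_def)
qed

lemma ip_one_one: "ip (\<lambda>_. 1) (\<lambda>_. 1) = 1"
  by (simp add: ip_def p_sum)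

lemma kernel_one: "kernel (1\<^sub>m d)"
  by (auto simp: kernel_def row_stochastic_def if_distrib[of "\<lambda>x. _ * x"] cong: if_cong)

lemma kernel_mult:
  assumes A: "kernel A" and B: "kernel B"
  shows "kernel (A * B)"
proof -
  note c = kernel_carrier[OF A] kernel_carrier[OF B]
  have "(\<Sum>j<d. (A * B) $$ (i, j)) = 1" if "i < d" for i
  proof -
    have "(\<Sum>j<d. (A * B) $$ (i, j)) = app d (A * B) (\<lambda>_. 1) i" by (simp add: app_def)
    also have "\<dots> = app d A (app d B (\<lambda>_. 1)) i" by (rule app_mult[OF c that])
    also have "\<dots> = app d A (\<lambda>_. 1) i" by (intro app_cong kernel_app_const B)
    finally show ?thesis using kernel_app_const[OF A that] by simp
  qed
  moreover have "0 \<le> (A * B) $$ (i, j)" if "i < d" "j < d" for i j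
    unfolding mult_entry[OF c that] using that kernel_nonneg A B by (intro sum_nonneg) simp
  moreover have "(\<Sum>i<d. p i * (A * B) $$ (i, j)) = p j" if "j < d" for j
  proof -
    have "(\<Sum>i<d. p i * (A * B) $$ (i, j)) = (\<Sum>i<d. \<Sum>k<d. p i * A $$ (i, k) * B $$ (k, j))"
      using mult_entry[OF c _ that] by (simp add: sum_distrib_left mult.assoc)
    also have "\<dots> = (\<Sum>k<d. (\<Sum>i<d. p i * A $$ (i, k)) * B $$ (k, j))"
      unfolding sum_distrib_right by (rule sum.swap)
    also have "\<dots> = p j" using A B that by (simp add: kernel_def)
    finally show ?thesis .
  qed
  ultimately show ?thesis using c by (simp add: kernel_def row_stochastic_def)
qed

lemma kernel_pow: "kernel Q \<Longrightarrow> kernel (Q ^\<^sub>m k)"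
proof (induction k)
  case 0 then show ?case using kernel_one kernel_carrier[of Q] by auto
next
  case (Suc k) then show ?case by (simp add: kernel_mult)
qed

text \<open>
  The loss of squared norm is the average conditional variance: \<open>Q f\<close> is the conditional mean of
  \<open>f\<close> after one step, and stationarity preserves the second moment of \<open>f\<close>.
\<close>

lemma kernel_defect:
  assumes Q: "kernel Q"
  shows "ip f f - ip (app d Q f) (app d Q f) =
    (\<Sum>i<d. p i * (\<Sum>j<d. Q $$ (i, j) * (f j - app d Q f i)\<^sup>2))"
proof -
  have row: "(\<Sum>j<d. Q $$ (i, j) * (f j - app d Q f i)\<^sup>2) =
      app d Q (\<lambda>j. (f j)\<^sup>2) i - (app d Q f i)\<^sup>2" if "i < d" for i
  proof -
    let ?m = "app d Q f i"
    have "(\<Sum>j<d. Q $$ (i, j) * (f j - ?m)\<^sup>2) =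
        (\<Sum>j<d. Q $$ (i, j) * (f j)\<^sup>2 - 2 * ?m * (Q $$ (i, j) * f j) + ?m\<^sup>2 * Q $$ (i, j))"
      by (simp add: power2_eq_square algebra_simps)
    also have "\<dots> = app d Q (\<lambda>j. (f j)\<^sup>2) i - 2 * ?m * ?m + ?m\<^sup>2 * (\<Sum>j<d. Q $$ (i, j))"
      by (simp add: sum.distrib sum_subtractf sum_distrib_left[symmetric] app_def)
    finally show ?thesis
      using Q that by (simp add: kernel_def row_stochastic_def power2_eq_square)
  qed
  have "(\<Sum>i<d. p i * (\<Sum>j<d. Q $$ (i, j) * (f j - app d Q f i)\<^sup>2)) =
     ip (app d Q (\<lambda>j. (f j)\<^sup>2)) (\<lambda>_. 1) - ip (app d Q f) (app d Q f)"
    unfolding ip_def sum_subtractf[symmetric]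
  proof (intro sum.cong refl)
    fix i assume "i \<in> {..<d}"
    then show "p i * (\<Sum>j<d. Q $$ (i, j) * (f j - app d Q f i)\<^sup>2) =
        p i * app d Q (\<lambda>j. (f j)\<^sup>2) i * 1 - p i * app d Q f i * app d Q f i"
      by (subst row) (simp_all add: right_diff_distrib power2_eq_square)
  qed
  also have "ip (app d Q (\<lambda>j. (f j)\<^sup>2)) (\<lambda>_. 1) = ip f f"
    unfolding kernel_ip_one[OF Q] by (simp add: ip_def power2_eq_square mult.assoc)
  finally show ?thesis by simp
qed

lemma kernel_contraction:
  assumes Q: "kernel Q" shows "ip (app d Q f) (app d Q f) \<le> ip f f"
proof -
  have "0 \<le> ip f f - ip (app d Q f) (app d Q f)"
    unfolding kernel_defect[OF Q] using kernel_nonneg[OF Q] p_pos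
    by (intro sum_nonneg mult_nonneg_nonneg) (auto simp: less_imp_le)
  then show ?thesis by simp
qed

text \<open>
  No loss of norm means that every conditional variance vanishes; when all transition probabilities
  are positive this makes \<open>f\<close> constant, and a constant of mean zero is zero.
\<close>

lemma positive_kernel_strict_contraction:
  assumes Q: "kernel Q" and pos: "\<And>i j. i < d \<Longrightarrow> j < d \<Longrightarrow> 0 < Q $$ (i, j)"
    and mean: "ip f (\<lambda>_. 1) = 0" and ge: "ip f f \<le> ip (app d Q f) (app d Q f)"
  shows "ip f f = 0"
proof -
  have nn: "0 \<le> (\<Sum>j<d. Q $$ (i, j) * (f j - app d Q f i)\<^sup>2)" if "i < d" for i
    using kernel_nonneg[OF Q] that by (intro sum_nonneg) simp
  have "(\<Sum>i<d. p i * (\<Sum>j<d. Q $$ (i, j) * (f j - app d Q f i)\<^sup>2)) = 0"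
    unfolding kernel_defect[OF Q, symmetric] using ge kernel_contraction[OF Q, of f] by simp
  then have *: "\<forall>i\<in>{..<d}. p i * (\<Sum>j<d. Q $$ (i, j) * (f j - app d Q f i)\<^sup>2) = 0"
    using nn p_pos by (subst (asm) sum_nonneg_eq_0_iff) (auto simp: less_imp_le)
  then have row: "(\<Sum>j<d. Q $$ (i, j) * (f j - app d Q f i)\<^sup>2) = 0" if "i < d" for i
  proof -
    have "p i * (\<Sum>j<d. Q $$ (i, j) * (f j - app d Q f i)\<^sup>2) = 0" using * that by blast
    then show ?thesis using p_pos[OF that] by simp
  qed
  have eq: "f j = app d Q f i" if "i < d" "j < d" for i j
  proof -
    have "\<forall>j\<in>{..<d}. Q $$ (i, j) * (f j - app d Q f i)\<^sup>2 = 0"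
      using row[OF that(1)] kernel_nonneg[OF Q that(1)]
      by (subst (asm) sum_nonneg_eq_0_iff) auto
    then have "Q $$ (i, j) * (f j - app d Q f i)\<^sup>2 = 0" using that by blast
    then show ?thesis using pos[OF that] by simp
  qed
  define c where "c = app d Q f 0"
  have fc: "f j = c" if "j < d" for j using eq[of 0 j] that by (simp add: c_def)
  have "ip f (\<lambda>_. 1) = (\<Sum>i<d. p i) * c"
    unfolding ip_def sum_distrib_right using fc by simp
  then have "c = 0" using mean p_sum by simp
  then show ?thesis using ip_self_eq_0 fc by simp
qed

text \<open>
  The adjoint of \<open>Q\<close> for the weighted inner product; for \<open>p = pmf \<pi>\<close> this is the time reversal.
\<close>

definition reversal :: "real mat \<Rightarrow> real mat" where
  "reversal Q = mat d d (\<lambda>(i, j). p j * Q $$ (j, i) / p i)"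

lemma reversal_carrier[simp]: "reversal Q \<in> carrier_mat d d"
  by (simp add: reversal_def)

lemma reversal_entry: "i < d \<Longrightarrow> j < d \<Longrightarrow> reversal Q $$ (i, j) = p j * Q $$ (j, i) / p i"
  by (simp add: reversal_def)

lemma reversal_mult:
  assumes "A \<in> carrier_mat d d" "B \<in> carrier_mat d d"
  shows "reversal (A * B) = reversal B * reversal A"
proof (rule eq_matI)
  fix i j assume "i < dim_row (reversal B * reversal A)" "j < dim_col (reversal B * reversal A)"
  then have ij: "i < d" "j < d" by (auto simp: reversal_def)
  have "(reversal B * reversal A) $$ (i, j) = (\<Sum>k<d. reversal B $$ (i, k) * reversal A $$ (k, j))"
    using ij by (intro mult_entry) auto
  also have "\<dots> = (\<Sum>k<d. p j * (A $$ (j, k) * B $$ (k, i)) / p i)"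
  proof (intro sum.cong refl)
    fix k assume "k \<in> {..<d}"
    then show "reversal B $$ (i, k) * reversal A $$ (k, j) = p j * (A $$ (j, k) * B $$ (k, i)) / p i"
      using ij p_pos[of k] by (simp add: reversal_entry)
  qed
  also have "\<dots> = reversal (A * B) $$ (i, j)"
    unfolding reversal_entry[OF ij] mult_entry[OF assms ij(2,1)]
    by (simp add: sum_distrib_left sum_divide_distrib)
  finally show "reversal (A * B) $$ (i, j) = (reversal B * reversal A) $$ (i, j)" by simp
qed (auto simp: reversal_def)

lemma reversal_pow:
  assumes "A \<in> carrier_mat d d"
  shows "reversal A ^\<^sub>m k = reversal (A ^\<^sub>m k)"
proof (induction k)
  case 0
  show ?case using assms p_pos by (intro eq_matI) (auto simp: reversal_def less_imp_neq[symmetric])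
next
  case (Suc k)
  have comm: "A * A ^\<^sub>m k = A ^\<^sub>m k * A"
  proof (induction k)
    case (Suc k)
    have "A * (A ^\<^sub>m k * A) = A * A ^\<^sub>m k * A"
      using assms by (intro assoc_mult_mat[symmetric, of _ d d _ d _ d]) auto
    then show ?case using Suc by simp
  qed (use assms in auto)
  have "reversal A ^\<^sub>m Suc k = reversal (A * A ^\<^sub>m k)"
    using Suc reversal_mult[of A "A ^\<^sub>m k"] assms by simp
  then show ?case using comm by simp
qed

lemma ip_app_reversal:
  assumes "Q \<in> carrier_mat d d"
  shows "ip f (app d (reversal Q) g) = ip (app d Q f) g"
proof -
  have "ip f (app d (reversal Q) g) = (\<Sum>i<d. \<Sum>j<d. p j * Q $$ (j, i) * f i * g j)"
    unfolding ip_def app_def sum_distrib_left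
  proof (intro sum.cong refl)
    fix i j assume "i \<in> {..<d}" "j \<in> {..<d}"
    then show "p i * f i * (reversal Q $$ (i, j) * g j) = p j * Q $$ (j, i) * f i * g j"
      using p_pos[of i] by (simp add: reversal_entry)
  qed
  also have "\<dots> = ip (app d Q f) g"
    unfolding ip_def app_def sum_distrib_left sum_distrib_right
    by (subst sum.swap) (simp add: mult_ac)
  finally show ?thesis .
qed

lemma ip_app_rev_mult:
  assumes Q: "Q \<in> carrier_mat d d"
  shows "ip f (app d (reversal Q * Q) g) = ip (app d Q f) (app d Q g)"
proof -
  have "ip f (app d (reversal Q * Q) g) = ip f (app d (reversal Q) (app d Q g))"
    using Q by (intro ip_cong app_mult) auto
  then show ?thesis using ip_app_reversal[OF Q] by simp
qed

lemma reversible_rev_mult: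
  assumes Q: "Q \<in> carrier_mat d d"
  shows "reversible (reversal Q * Q)"
proof -
  have "p i * (reversal Q * Q) $$ (i, j) = (\<Sum>k<d. p k * Q $$ (k, i) * Q $$ (k, j))"
    if "i < d" "j < d" for i j
    unfolding mult_entry[OF reversal_carrier Q that] sum_distrib_left
  proof (intro sum.cong refl)
    fix k assume "k \<in> {..<d}"
    then show "p i * (reversal Q $$ (i, k) * Q $$ (k, j)) = p k * Q $$ (k, i) * Q $$ (k, j)"
      using p_pos[of i] that by (simp add: reversal_entry)
  qed
  moreover have "reversal Q * Q \<in> carrier_mat d d" using Q by (intro mult_carrier_mat) auto
  ultimately show ?thesis by (simp add: reversible_def mult_ac)
qed

lemma app_rev_mult_one:
  assumes Q: "kernel Q" and i: "i < d"
  shows "app d (reversal Q * Q) (\<lambda>_. 1) i = 1"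
proof -
  have "app d (reversal Q * Q) (\<lambda>_. 1) i = app d (reversal Q) (app d Q (\<lambda>_. 1)) i"
    using kernel_carrier[OF Q] i by (intro app_mult) auto
  also have "\<dots> = app d (reversal Q) (\<lambda>_. 1) i"
    by (intro app_cong kernel_app_const Q)
  also have "\<dots> = (\<Sum>j<d. p j * Q $$ (j, i)) / p i"
    using i by (simp add: app_def reversal_entry sum_divide_distrib)
  also have "\<dots> = 1" using Q i p_pos[OF i] by (simp add: kernel_def)
  finally show ?thesis .
qed

lemma real_eigenvalues_reversible:
  assumes "reversible A"
  shows "char_poly A = (\<Prod>e\<leftarrow>real_eigenvalues A. [:- e, 1:])"
    and "length (real_eigenvalues A) = d"
    and "i \<le> j \<Longrightarrow> j < d \<Longrightarrow> real_eigenvalues A ! j \<le> real_eigenvalues A ! i"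
proof -
  obtain es where es: "char_poly A = (\<Prod>e\<leftarrow>es. [:- e, 1:])" "length es = d"
    using reversible_char_poly_splits[OF assms] .
  have re: "real_eigenvalues A = rev (sort es)"
    unfolding real_eigenvalues_def es(1) proots_linear_factors
    by (simp add: sorted_list_of_multiset_mset)
  then have ms: "mset (real_eigenvalues A) = mset es" by simp
  have "(\<Prod>e\<leftarrow>es. [:- e, 1:]) = prod_mset (image_mset (\<lambda>e. [:- e, 1:]) (mset es))"
    by (simp add: prod_mset_prod_list flip: mset_map)
  also have "\<dots> = (\<Prod>e\<leftarrow>real_eigenvalues A. [:- e, 1:])"
    unfolding ms[symmetric] by (simp add: prod_mset_prod_list flip: mset_map)
  finally show "char_poly A = (\<Prod>e\<leftarrow>real_eigenvalues A. [:- e, 1:])" using es by simp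
  show len: "length (real_eigenvalues A) = d" using re es by simp
  show "real_eigenvalues A ! j \<le> real_eigenvalues A ! i" if "i \<le> j" "j < d"
    by (rule sorted_rev_nth_mono) (use that len in \<open>simp_all add: re\<close>)
qed

text \<open>
  Work in an orthogonal eigenbasis of \<open>Q\<^sup>\<dagger> Q\<close> with decreasing eigenvalues. The squared norm of
  \<open>Q f\<close> is the quadratic form of \<open>Q\<^sup>\<dagger> Q\<close> at \<open>f\<close>, so the eigenvalues are nonnegative. If the second one
  is below 1, constants are orthogonal to all eigenvectors but the first, hence a mean-zero \<open>f\<close> is
  orthogonal to the first and the form is at most the second eigenvalue times the squared norm of \<open>f\<close>;
  otherwise the bound is the plain contraction. If the second eigenvalue were at least 1 for a positive
  kernel, the span of the first two eigenvectors would contain a nonzero mean-zero function whose norm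
  does not decrease.
\<close>

lemma spectral_gap_props:
  assumes d2: "2 \<le> d" and Q: "kernel Q"
  defines "g \<equiv> spectral_gap (reversal Q * Q)"
  shows spectral_gap_le_1: "g \<le> 1"
    and spectral_gap_contraction:
      "\<And>f. ip f (\<lambda>_. 1) = 0 \<Longrightarrow> ip (app d Q f) (app d Q f) \<le> (1 - g) * ip f f"
    and spectral_gap_pos: "(\<And>i j. i < d \<Longrightarrow> j < d \<Longrightarrow> 0 < Q $$ (i, j)) \<Longrightarrow> 0 < g"
proof -
  let ?A = "reversal Q * Q"
  let ?one = "\<lambda>_::nat. 1::real"
  define es where "es = real_eigenvalues ?A"
  note Qc = kernel_carrier[OF Q]
  note rA = reversible_rev_mult[OF Qc]
  note E = real_eigenvalues_reversible[OF rA, folded es_def]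
  have g: "g = 1 - es ! 1" using d2 by (simp add: g_def spectral_gap_def es_def reversal_def)
  obtain u where
    eig: "\<And>j i. j < d \<Longrightarrow> i < d \<Longrightarrow> app d ?A (u j) i = es ! j * u j i" and
    pos: "\<And>j. j < d \<Longrightarrow> 0 < ip (u j) (u j)" and
    orth: "\<And>j k. j < d \<Longrightarrow> k < d \<Longrightarrow> j \<noteq> k \<Longrightarrow> ip (u j) (u k) = 0" and
    exp: "\<And>f x. x < d \<Longrightarrow> f x = (\<Sum>j<d. ip f (u j) / ip (u j) (u j) * u j x)"
    by (rule reversible_eigenbasis[OF rA E(1)]) (rule that, assumption+)
  have Qq: "ip (app d Q f) (app d Q f) = (\<Sum>j<d. es ! j * ((ip f (u j))\<^sup>2 / ip (u j) (u j)))"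
    and nq: "ip f f = (\<Sum>j<d. (ip f (u j))\<^sup>2 / ip (u j) (u j))" for f
    using ip_eigen_expansion[OF eig pos exp, of f] ip_app_rev_mult[OF Qc, of f f] by auto
  have eig_ip: "es ! j * ip (u j) g = ip (u j) (app d ?A g)" if "j < d" for j g
  proof -
    have "ip (u j) (app d ?A g) = ip (app d ?A (u j)) g" by (rule ip_app_commute[OF rA, symmetric])
    also have "\<dots> = ip (\<lambda>i. es ! j * u j i) g" using that eig by (intro ip_cong) auto
    finally show ?thesis by (simp add: ip_scale)
  qed
  have "0 \<le> es ! 1"
  proof -
    have "es ! 1 * ip (u 1) (u 1) = ip (app d Q (u 1)) (app d Q (u 1))"
      using eig_ip[of 1 "u 1"] d2 ip_app_rev_mult[OF Qc] by simp
    then show ?thesis using pos[of 1] d2 ip_self_nonneg[of "app d Q (u 1)"]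
      by (metis less_le_trans one_less_numeral_iff semiring_norm(76) zero_le_mult_iff not_less)
  qed
  then show "g \<le> 1" using g by simp
  show "ip (app d Q f) (app d Q f) \<le> (1 - g) * ip f f" if f: "ip f ?one = 0" for f
  proof (cases "es ! 1 \<ge> 1")
    case True
    have "ip (app d Q f) (app d Q f) \<le> 1 * ip f f" using kernel_contraction[OF Q] by simp
    also have "\<dots> \<le> (1 - g) * ip f f" using True g ip_self_nonneg by (intro mult_right_mono) auto
    finally show ?thesis .
  next
    case False
    have one_orth: "ip ?one (u j) = 0" if "j < d" "j \<noteq> 0" for j
    proof -
      have "es ! j \<le> es ! 1" using that E(3)[of 1 j] by simp
      moreover have "es ! j * ip (u j) ?one = ip (u j) ?one"
        unfolding eig_ip[OF that(1)] using app_rev_mult_one[OF Q] by (intro ip_cong) auto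
      ultimately show ?thesis using False by (simp add: ip_commute)
    qed
    have one0: "1 = ip ?one (u 0) / ip (u 0) (u 0) * u 0 x" if "x < d" for x
    proof -
      have "(\<Sum>j\<in>{..<d} - {0}. ip ?one (u j) / ip (u j) (u j) * u j x) = 0"
        using one_orth by (intro sum.neutral) auto
      then have "(\<Sum>j<d. ip ?one (u j) / ip (u j) (u j) * u j x) =
            ip ?one (u 0) / ip (u 0) (u 0) * u 0 x"
        using d2 by (subst sum.remove[of _ 0]) auto
      moreover have "1 = (\<Sum>j<d. ip ?one (u j) / ip (u j) (u j) * u j x)"
        by (rule exp[OF that])
      ultimately show ?thesis by (rule trans[rotated])
    qed
    define c where "c = ip ?one (u 0) / ip (u 0) (u 0)"
    have "ip f ?one = ip ?one f" by (rule ip_commute)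
    also have "\<dots> = ip (\<lambda>x. c * u 0 x) f"
      by (intro ip_cong one0[folded c_def] refl)
    finally have "c * ip (u 0) f = 0" using f by (simp add: ip_scale)
    moreover have "c \<noteq> 0" using one0[of 0] d2 by (auto simp: c_def)
    ultimately have f0: "ip f (u 0) = 0" by (simp add: ip_commute)
    have "es ! j * ((ip f (u j))\<^sup>2 / ip (u j) (u j)) \<le> (1 - g) * ((ip f (u j))\<^sup>2 / ip (u j) (u j))"
      if "j < d" for j
    proof (cases "j = 0")
      case False
      then have "es ! j \<le> 1 - g" using E(3)[of 1 j] that g by simp
      then show ?thesis using pos[OF that] by (intro mult_right_mono) auto
    qed (simp add: f0)
    then show ?thesis unfolding Qq nq[of f] sum_distrib_left by (intro sum_mono) auto
  qed
  show "0 < g" if Qpos: "\<And>i j. i < d \<Longrightarrow> j < d \<Longrightarrow> 0 < Q $$ (i, j)"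
  proof (rule ccontr)
    assume "\<not> 0 < g"
    then have e1: "es ! 1 \<ge> 1" using g by simp
    then have e0: "es ! 0 \<ge> 1" using E(3)[of 0 1] d2 by simp
    define a where "a = (if ip (u 1) ?one = 0 \<and> ip (u 0) ?one = 0 then 1 else ip (u 1) ?one)"
    define b where "b = - ip (u 0) ?one"
    have ab: "a \<noteq> 0 \<or> b \<noteq> 0" by (auto simp: a_def b_def)
    define f where "f = (\<lambda>x. a * u 0 x + b * u 1 x)"
    have mean: "ip f ?one = 0" 
      unfolding f_def ip_add ip_scale by (simp add: a_def b_def)
    have fu: "ip f (u j) = (if j = 0 then a * ip (u 0) (u 0) else if j = 1 then b * ip (u 1) (u 1) else 0)"
      if "j < d" for j
      unfolding f_def ip_add ip_scale using orth[of 0 j] orth[of 1 j] that d2 by auto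
    have "ip f f \<le> ip (app d Q f) (app d Q f)"
      unfolding Qq nq[of f]
    proof (intro sum_mono)
      fix j assume "j \<in> {..<d}"
      then show "(ip f (u j))\<^sup>2 / ip (u j) (u j) \<le> es ! j * ((ip f (u j))\<^sup>2 / ip (u j) (u j))"
        using pos[of j] fu[of j] e0 e1 mult_right_mono[of 1 "es ! j" "(ip f (u j))\<^sup>2 / ip (u j) (u j)"]
        by (cases "j = 0"; cases "j = 1") auto
    qed
    then have "ip f f = 0" using positive_kernel_strict_contraction[OF Q Qpos mean] by simp
    moreover have "ip f f = a\<^sup>2 * ip (u 0) (u 0) + b\<^sup>2 * ip (u 1) (u 1)"
    proof -
      have "ip f f = a * ip (u 0) f + b * ip (u 1) f"
        by (subst (1) f_def, subst ip_add, subst (1 2) ip_scale) (rule refl)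
      also have "\<dots> = a * ip f (u 0) + b * ip f (u 1)"
        by (subst (1 2) ip_commute) (rule refl)
      finally show ?thesis using fu[of 0] fu[of 1] d2 by (simp add: power2_eq_square)
    qed
    moreover have "0 < a\<^sup>2 * ip (u 0) (u 0) + b\<^sup>2 * ip (u 1) (u 1)"
    proof (cases "a = 0")
      case True
      then show ?thesis using ab pos[of 1] d2 by simp
    next
      case False
      then show ?thesis using pos[of 0] pos[of 1] d2 by (intro add_pos_nonneg) auto
    qed
    ultimately show False by simp
  qed
qed

end

section \<open>The norm of a tilted kernel\<close>

lemma nonneg_of_pos_mult: "0 \<le> c * z \<Longrightarrow> 0 < c \<Longrightarrow> 0 \<le> (z::real)"
  by (simp add: zero_le_mult_iff)

text \<open>
  With \<open>a\<close> the value at the distinguished state, of mass \<open>p\<close>, and \<open>\<beta>\<close>, \<open>B\<close> the first and second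
  moments over its complement, the left-hand side is the quadratic form of a chain that jumps to
  stationarity with probability \<open>g\<close> and otherwise stays, tilted by \<open>y\<close> on both sides. The claim is that
  \<open>1 + s\<close> is at least its largest eigenvalue. By \<open>\<beta>\<^sup>2 \<le> q B\<close> this reduces to a two by two matrix whose
  determinant is \<open>g (s - u p) + s (s - u (1 - g q))\<close>. Its root near 0 is \<open>u p\<close> to first order in \<open>u\<close>, and
  the surplus \<open>2 u\<^sup>2 p / g\<close> in \<open>s\<close> pays for the second-order term.
\<close>

lemma two_state_inequality:
  fixes p q g u y a B \<beta> :: real
  assumes p: "0 < p" and q: "0 < q" and pq: "p + q = 1" and g: "0 < g" "g \<le> 1"
    and u: "\<bar>u\<bar> \<le> g / 2" and y: "y\<^sup>2 = 1 + u" and B: "\<beta>\<^sup>2 \<le> q * B"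
  defines "s \<equiv> u * p + 2 * u\<^sup>2 * p / g"
  shows "(1 - g) * (y\<^sup>2 * p * a\<^sup>2 + B) + g * (y * p * a + \<beta>)\<^sup>2 \<le> (1 + s) * (p * a\<^sup>2 + B)"
proof -
  define t where "t = g * p + s"
  \<comment> \<open>The diagonal entries of the two by two matrix are \<open>\<alpha>\<close> and \<open>t\<close>, once \<open>B\<close> has absorbed \<open>\<beta>\<^sup>2\<close>.\<close>
  define \<alpha> where "\<alpha> = g * q + s - u * (1 - g * q)"
  have u2: "u\<^sup>2 \<le> \<bar>u\<bar> * (g / 2)"
    using mult_left_mono[OF u, of "\<bar>u\<bar>"] by (simp add: power2_eq_square)
  have s_abs: "g * s = p * (g * u + 2 * u\<^sup>2)" using g by (simp add: s_def field_simps)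
  have "g * t = p * (g\<^sup>2 + g * u + 2 * u\<^sup>2)"
    using s_abs by (simp add: t_def algebra_simps power2_eq_square)
  moreover have "g * (- u) \<le> g * (g / 2)" using u g by (intro mult_left_mono) auto
  then have "g * g / 2 \<le> g\<^sup>2 + g * u" by (simp add: power2_eq_square)
  then have "0 < g\<^sup>2 + g * u + 2 * u\<^sup>2"
    using g(1) by (smt (verit) divide_pos_pos mult_pos_pos zero_le_power2)
  ultimately have "0 < g * t" using p by simp
  then have t: "0 < t" using g by (simp add: zero_less_mult_iff)
  have prod: "\<alpha> * t - g\<^sup>2 * p * q * (1 + u) = g * (s - u * p) + s * (s - u * (1 - g * q))"
  proof -
    have q': "q = 1 - p" using pq by simp
    show ?thesis unfolding \<alpha>_def t_def q' by (simp add: algebra_simps power2_eq_square)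
  qed
  have sp: "g * (s - u * p) = 2 * u\<^sup>2 * p" using g by (simp add: s_def)
  have "0 \<le> g * (s - u * p) + s * (s - u * (1 - g * q))"
  proof -
    have s2: "\<bar>s\<bar> \<le> 2 * \<bar>u\<bar> * p"
    proof -
      have "2 * u\<^sup>2 * p / g \<le> \<bar>u\<bar> * p"
        using u2 mult_right_mono[OF u2, of "2 * p"] p g by (simp add: field_simps)
      moreover have "0 \<le> 2 * u\<^sup>2 * p / g" using p g by simp
      moreover have "\<bar>u * p\<bar> = \<bar>u\<bar> * p" using p by (simp add: abs_mult)
      ultimately show ?thesis unfolding s_def by linarith
    qed
    have gq: "0 \<le> 1 - g * q" "1 - g * q \<le> 1"
      using g q p pq mult_le_one[of g q] by auto
    have "\<bar>s * (u * (1 - g * q))\<bar> = \<bar>s\<bar> * \<bar>u\<bar> * (1 - g * q)"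
      using gq by (simp add: abs_mult)
    also have "\<dots> \<le> \<bar>s\<bar> * \<bar>u\<bar>" using gq by (simp add: mult_left_le)
    also have "\<dots> \<le> 2 * \<bar>u\<bar> * p * \<bar>u\<bar>" using s2 by (intro mult_right_mono) auto
    also have "\<dots> = g * (s - u * p)" unfolding sp by (simp add: power2_eq_square)
    finally have "s * (u * (1 - g * q)) \<le> g * (s - u * p)" by linarith
    moreover have "0 \<le> s * s" by (rule zero_le_square)
    ultimately show ?thesis by (subst right_diff_distrib[of s]) linarith
  qed
  then have \<alpha>t: "g\<^sup>2 * p * q * y\<^sup>2 \<le> \<alpha> * t" using prod y by simp
  have id: "(1 + s) * (p * a\<^sup>2 + B) - ((1 - g) * (y\<^sup>2 * p * a\<^sup>2 + B) + g * (y * p * a + \<beta>)\<^sup>2)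
      = p * a\<^sup>2 * \<alpha> + B * (s + g) - 2 * g * y * p * a * \<beta> - g * \<beta>\<^sup>2"
  proof -
    have q': "q = 1 - p" using pq by simp
    have "(1 + s) * (p * a\<^sup>2 + B) - ((1 - g) * (y\<^sup>2 * p * a\<^sup>2 + B) + g * (y * p * a + \<beta>)\<^sup>2)
      = p * a\<^sup>2 * (1 + s - (1 - g) * y\<^sup>2 - g * p * y\<^sup>2) + B * (s + g) - 2 * g * y * p * a * \<beta> - g * \<beta>\<^sup>2"
      by (simp add: algebra_simps power2_eq_square)
    also have "1 + s - (1 - g) * y\<^sup>2 - g * p * y\<^sup>2 = \<alpha>"
      unfolding \<alpha>_def q' y by (simp add: algebra_simps power2_eq_square)
    finally show ?thesis .
  qed
  have "0 \<le> q * t * (p * a\<^sup>2 * \<alpha> + B * t - 2 * g * y * p * a * \<beta>)"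
  proof -
    have "0 \<le> (p * q * g * y * a - \<beta> * t)\<^sup>2" by simp
    also have "\<dots> = q * p * a\<^sup>2 * (g\<^sup>2 * p * q * y\<^sup>2) + \<beta>\<^sup>2 * t\<^sup>2 - q * t * (2 * g * y * p * a * \<beta>)"
      by (simp add: algebra_simps power2_eq_square)
    also have "\<dots> \<le> q * p * a\<^sup>2 * (\<alpha> * t) + q * B * t\<^sup>2 - q * t * (2 * g * y * p * a * \<beta>)"
      using \<alpha>t B p q by (intro diff_right_mono add_mono mult_left_mono mult_right_mono) auto
    also have "\<dots> = q * t * (p * a\<^sup>2 * \<alpha> + B * t - 2 * g * y * p * a * \<beta>)" by (simp add: algebra_simps power2_eq_square)
    finally show ?thesis .
  qed
  then have "0 \<le> p * a\<^sup>2 * \<alpha> + B * t - 2 * g * y * p * a * \<beta>"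
    by (rule nonneg_of_pos_mult[OF _ mult_pos_pos[OF q t]])
  moreover have "g * \<beta>\<^sup>2 \<le> g * (q * B)" using B g by simp
  moreover have "B * (s + g) - g * (q * B) = B * t"
  proof -
    have q': "q = 1 - p" using pq by simp
    show ?thesis unfolding t_def q' by (simp add: algebra_simps power2_eq_square)
  qed
  ultimately show ?thesis using id by linarith
qed

definition tilt :: "real \<Rightarrow> nat \<Rightarrow> nat \<Rightarrow> real" where
  "tilt y i x = (if x = i then y else 1)"

context prob_weights
begin

text \<open>
  Some power of \<open>M\<close> is positive and so has a positive gap, while the quotients are at most
  \<open>1 / k\<close>; hence only finitely many lags compete, and the greatest element is a maximum over a finite
  set.
\<close>

lemma pseudo_spectral_gap_attained:
  assumes d2: "2 \<le> d" and M: "kernel M" and erg: "ergodic d M"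
    and rev: "time_reversal d \<pi> M = reversal M"
  obtains k g where "1 \<le> k" "0 < g" "g \<le> 1" "pseudo_spectral_gap d \<pi> M = g / real k"
    "\<And>f. ip f (\<lambda>_. 1) = 0 \<Longrightarrow>
       ip (app d (M ^\<^sub>m k) f) (app d (M ^\<^sub>m k) f) \<le> (1 - g) * ip f f"
proof -
  define gap where "gap k = spectral_gap (reversal (M ^\<^sub>m k) * M ^\<^sub>m k)" for k
  define R where "R x \<longleftrightarrow> (\<exists>k\<ge>1. x = gap k / real k)" for x
  have ps: "pseudo_spectral_gap d \<pi> M = Greatest R"
    unfolding pseudo_spectral_gap_def rev reversal_pow[OF kernel_carrier[OF M]] R_def gap_def ..
  note props = spectral_gap_props[OF d2 kernel_pow[OF M], folded gap_def]
  obtain k0 where k0: "1 \<le> k0" "\<And>i j. i < d \<Longrightarrow> j < d \<Longrightarrow> 0 < (M ^\<^sub>m k0) $$ (i, j)"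
    using erg unfolding ergodic_def by blast
  have gk0: "0 < gap k0" by (rule props(3)) (rule k0)
  define N where "N = nat \<lceil>real k0 / gap k0\<rceil>"
  have N: "real k0 / gap k0 \<le> real N" unfolding N_def by linarith
  have "real k0 \<le> real k0 / gap k0" using gk0 props(1)[of k0] by (simp add: field_simps mult_left_le)
  then have k0N: "k0 \<le> N" using N by linarith
  define S where "S = (\<lambda>k. gap k / real k) ` {1..N}"
  have S: "finite S" "S \<noteq> {}" using k0 k0N by (auto simp: S_def)
  have top: "x \<le> Max S" if "R x" for x
  proof -
    from that obtain k where k: "1 \<le> k" "x = gap k / real k" unfolding R_def by blast
    show ?thesis
    proof (cases "k \<le> N")
      case True
      then show ?thesis using k S by (intro Max_ge) (auto simp: S_def)
    next
      case False
      then have "real k0 / gap k0 \<le> real k" using N by linarith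
      then have "1 / real k \<le> gap k0 / real k0" using gk0 k0(1) k(1) by (simp add: field_simps)
      moreover have "x \<le> 1 / real k" using props(1)[of k] k by (simp add: divide_right_mono)
      moreover have "gap k0 / real k0 \<le> Max S" using k0(1) k0N S by (intro Max_ge) (auto simp: S_def)
      ultimately show ?thesis by linarith
    qed
  qed
  obtain k where k: "1 \<le> k" "Max S = gap k / real k"
    using Max_in[OF S] by (auto simp: S_def)
  then have "R (Max S)" by (auto simp: R_def)
  then have G: "pseudo_spectral_gap d \<pi> M = gap k / real k"
    unfolding ps k(2)[symmetric] using top by (intro Greatest_equality)
  have "gap k0 / real k0 \<le> Max S" using k0(1) by (intro top) (auto simp: R_def)
  moreover have "0 < gap k0 / real k0" using gk0 k0(1) by simp
  ultimately have "0 < gap k / real k" using k(2) by linarith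
  then have "0 < gap k" using k(1) by (simp add: zero_less_divide_iff)
  then show ?thesis using that[OF k(1) _ props(1) G props(2)] by blast
qed

lemma mean_square_le: "(ip f (\<lambda>_. 1))\<^sup>2 \<le> ip f f"
proof -
  define m where "m = ip f (\<lambda>_. 1)"
  have "0 \<le> ip (\<lambda>x. f x - m) (\<lambda>x. f x - m)" by (rule ip_self_nonneg)
  also have "\<dots> = ip f f - 2 * m * ip f (\<lambda>_. 1) + m\<^sup>2 * ip (\<lambda>_. 1) (\<lambda>_. 1)"
    by (simp add: ip_def algebra_simps power2_eq_square sum.distrib sum_subtractf sum_distrib_left)
  also have "\<dots> = ip f f - m\<^sup>2" by (simp add: ip_one_one m_def power2_eq_square)
  finally show ?thesis by (simp add: m_def)
qed

text \<open>
  Decompose \<open>v\<close> into its mean and a mean-zero part: the kernel fixes the former and contracts the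
  latter, so \<open>Q\<^sup>\<dagger> Q\<close> is dominated by a chain that jumps to stationarity with probability \<open>g\<close>.
\<close>

lemma kernel_gap_bound:
  assumes K: "kernel K"
    and gap: "\<And>f. ip f (\<lambda>_. 1) = 0 \<Longrightarrow> ip (app d K f) (app d K f) \<le> (1 - g) * ip f f"
  shows "ip (app d K v) (app d K v) \<le> (1 - g) * ip v v + g * (ip v (\<lambda>_. 1))\<^sup>2"
proof -
  define m where "m = ip v (\<lambda>_. 1)"
  define f where "f = (\<lambda>x. v x - m)"
  have ip_shift: "ip (\<lambda>x. h x + m) (\<lambda>x. h x + m) = ip h h + m\<^sup>2" if "ip h (\<lambda>_. 1) = 0" for h
  proof -
    have "ip (\<lambda>x. h x + m) (\<lambda>x. h x + m) = ip h h + 2 * m * ip h (\<lambda>_. 1) + m\<^sup>2 * ip (\<lambda>_. 1) (\<lambda>_. 1)"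
      by (simp add: ip_def algebra_simps power2_eq_square sum.distrib sum_distrib_left)
    then show ?thesis using that by (simp add: ip_one_one)
  qed
  have "ip f (\<lambda>_. 1) = m - m * ip (\<lambda>_. 1) (\<lambda>_. 1)"
    using ip_scale[of m "\<lambda>_. 1" "\<lambda>_. 1"] by (simp add: f_def ip_diff m_def)
  then have f0: "ip f (\<lambda>_. 1) = 0" by (simp add: ip_one_one)
  have "app d K v x = app d K f x + m" if "x < d" for x
    using kernel_app_const[OF K that, of m] by (simp add: f_def app_diff)
  then have "ip (app d K v) (app d K v) = ip (\<lambda>x. app d K f x + m) (\<lambda>x. app d K f x + m)"
    by (intro ip_cong) auto
  also have "\<dots> = ip (app d K f) (app d K f) + m\<^sup>2"
    using f0 kernel_ip_one[OF K, of f] by (intro ip_shift) simp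
  also have "\<dots> \<le> (1 - g) * ip f f + m\<^sup>2" using gap[OF f0] by simp
  also have "\<dots> = (1 - g) * (ip f f + m\<^sup>2) + g * m\<^sup>2"
    by (simp add: algebra_simps)
  also have "ip f f + m\<^sup>2 = ip v v" using ip_shift[OF f0] by (simp add: f_def)
  finally show ?thesis by (simp add: m_def)
qed

lemma tilted_kernel_norm:
  assumes K: "kernel K" and d2: "2 \<le> d" and i: "i < d"
    and g: "0 < g" "g \<le> 1" and u: "\<bar>u\<bar> \<le> g / 2" and y: "y\<^sup>2 = 1 + u"
    and gap: "\<And>f. ip f (\<lambda>_. 1) = 0 \<Longrightarrow> ip (app d K f) (app d K f) \<le> (1 - g) * ip f f"
  shows "ip (app d K (\<lambda>x. tilt y i x * v x)) (app d K (\<lambda>x. tilt y i x * v x))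
    \<le> (1 + (u * p i + 2 * u\<^sup>2 * p i / g)) * ip v v"
proof -
  define J where "J = {..<d} - {i}"
  have fJ: "finite J" by (simp add: J_def)
  define q where "q = sum p J"
  define a where "a = v i"
  define B where "B = (\<Sum>j\<in>J. p j * (v j)\<^sup>2)"
  define \<beta> where "\<beta> = (\<Sum>j\<in>J. p j * v j)"
  have split: "(\<Sum>j<d. f j) = f i + (\<Sum>j\<in>J. f j)" for f :: "nat \<Rightarrow> real"
    unfolding J_def using i by (subst sum.remove[of _ i]) auto
  have pq: "p i + q = 1" using split[of p] p_sum by (simp add: q_def)
  have "\<exists>j<d. j \<noteq> i" using d2 by (intro exI[of _ "if i = 0 then 1 else 0"]) auto
  then have "J \<noteq> {}" by (auto simp: J_def)
  then have q: "0 < q" unfolding q_def using p_pos by (intro sum_pos fJ) (auto simp: J_def)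
  have cs: "\<beta>\<^sup>2 \<le> q * B"
  proof -
    have "0 \<le> (\<Sum>j\<in>J. p j * (q * v j - \<beta>)\<^sup>2)"
      using p_pos by (intro sum_nonneg mult_nonneg_nonneg) (auto simp: J_def less_imp_le)
    also have "\<dots> = (\<Sum>j\<in>J. q\<^sup>2 * (p j * (v j)\<^sup>2) - 2 * q * \<beta> * (p j * v j) + \<beta>\<^sup>2 * p j)"
      by (simp add: power2_eq_square algebra_simps)
    also have "\<dots> = q\<^sup>2 * B - 2 * q * \<beta> * \<beta> + \<beta>\<^sup>2 * q"
      by (simp add: sum.distrib sum_subtractf sum_distrib_left[symmetric] B_def \<beta>_def q_def)
    also have "\<dots> = q * (q * B - \<beta>\<^sup>2)"
      by (simp add: algebra_simps power2_eq_square)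
    finally show ?thesis using q by (simp add: zero_le_mult_iff)
  qed
  let ?w = "\<lambda>x. tilt y i x * v x"
  have notJ: "j \<noteq> i" if "j \<in> J" for j using that by (simp add: J_def)
  have ww: "ip ?w ?w = y\<^sup>2 * p i * a\<^sup>2 + B"
    unfolding ip_def split a_def B_def using notJ
    by (simp add: tilt_def power2_eq_square mult_ac)
  have w1: "ip ?w (\<lambda>_. 1) = y * p i * a + \<beta>"
    unfolding ip_def split a_def \<beta>_def using notJ by (simp add: tilt_def mult_ac)
  have vv: "ip v v = p i * a\<^sup>2 + B"
    unfolding ip_def split a_def B_def by (simp add: power2_eq_square mult_ac)
  have "ip (app d K ?w) (app d K ?w) \<le> (1 - g) * ip ?w ?w + g * (ip ?w (\<lambda>_. 1))\<^sup>2"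
    by (rule kernel_gap_bound[OF K gap])
  also have "\<dots> \<le> (1 + (u * p i + 2 * u\<^sup>2 * p i / g)) * ip v v"
    unfolding ww w1 vv by (rule two_state_inequality[OF p_pos[OF i] q pq g u y cs])
  finally show ?thesis .
qed

end

section \<open>Path expectations by backward recursion\<close>

definition paths :: "nat \<Rightarrow> nat \<Rightarrow> nat list set" where
  "paths d m = {xs. length xs = m \<and> set xs \<subseteq> {..<d}}"

definition path_weight :: "real mat \<Rightarrow> nat list \<Rightarrow> real" where
  "path_weight M xs = (\<Prod>t<length xs - 1. M $$ (xs ! t, xs ! Suc t))"

text \<open>
  The expected product of the values of \<open>h\<close> at the \<open>n\<close> times \<open>s, s + 1, \<dots>\<close> along the chain, given
  that it occupies state \<open>x\<close> at time \<open>s\<close>.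
\<close>

fun backward :: "nat \<Rightarrow> real mat \<Rightarrow> (nat \<Rightarrow> nat \<Rightarrow> real) \<Rightarrow> nat \<Rightarrow> nat \<Rightarrow> nat \<Rightarrow> real" where
  "backward d M h 0 s = (\<lambda>_. 1)"
| "backward d M h (Suc n) s = (\<lambda>x. h s x * app d M (backward d M h n (Suc s)) x)"

lemma finite_paths: "finite (paths d m)"
  using finite_lists_length_eq[of "{..<d}" m] by (simp add: paths_def conj_commute)

lemma sum_paths_Suc: "(\<Sum>xs\<in>paths d (Suc n). f xs) = (\<Sum>x<d. \<Sum>ys\<in>paths d n. f (x # ys))"
proof -
  have "paths d (Suc n) = (\<lambda>(x, ys). x # ys) ` ({..<d} \<times> paths d n)"
    by (auto simp: paths_def length_Suc_conv image_iff)
  moreover have "inj_on (\<lambda>(x, ys). x # ys) ({..<d} \<times> paths d n)" by (auto simp: inj_on_def)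
  ultimately show ?thesis
    by (simp add: sum.reindex sum.cartesian_product case_prod_unfold)
qed

lemma paths_0: "paths d 0 = {[]}"
  by (auto simp: paths_def)

lemma paths_nth: "xs \<in> paths d m \<Longrightarrow> t < m \<Longrightarrow> xs ! t < d"
  using nth_mem[of t xs] by (auto simp only: paths_def mem_Collect_eq lessThan_iff subset_iff)

lemma path_weight_Cons_Cons: "path_weight M (x # y # zs) = M $$ (x, y) * path_weight M (y # zs)"
  unfolding path_weight_def by (simp add: prod.lessThan_Suc_shift del: prod.lessThan_Suc)

lemma app_pow_Suc:
  assumes M: "M \<in> carrier_mat d d" and i: "i < d"
  shows "app d (M ^\<^sub>m Suc r) f i = app d M (app d (M ^\<^sub>m r) f) i"
  using i
proof (induction r arbitrary: f i)
  case 0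
  have "1\<^sub>m (dim_row M) = 1\<^sub>m d" using M by simp
  then show ?case using M 0 by (simp add: app_cong[of d "app d (1\<^sub>m d) f" f] app_one)
next
  case (Suc r)
  have "app d (M ^\<^sub>m Suc r * M) f i = app d (M ^\<^sub>m Suc r) (app d M f) i"
    using M Suc.prems by (intro app_mult pow_carrier_mat)
  also have "\<dots> = app d M (app d (M ^\<^sub>m r) (app d M f)) i" by (rule Suc.IH[OF Suc.prems])
  also have "\<dots> = app d M (app d (M ^\<^sub>m r * M) f) i"
    using M by (intro app_cong app_mult[symmetric] pow_carrier_mat)
  finally show ?case by simp
qed

text \<open>
  The tilt acts only at times congruent to \<open>j\<close> modulo \<open>k\<close>, so that the product along a path is \<open>y\<close>
  to the power of the number of visits to \<open>i\<close> at those times.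
\<close>

definition sampled_tilt :: "nat \<Rightarrow> nat \<Rightarrow> real \<Rightarrow> nat \<Rightarrow> nat \<Rightarrow> nat \<Rightarrow> real" where
  "sampled_tilt k j y i t = (if t mod k = j then tilt y i else (\<lambda>_. 1))"

context prob_weights
begin

lemma sum_paths_backward:
  assumes M: "kernel M" and x: "x < d"
  shows "(\<Sum>ys\<in>paths d n. path_weight M (x # ys) * (\<Prod>t<Suc n. h (s + t) ((x # ys) ! t)))
    = backward d M h (Suc n) s x"
  using x
proof (induction n arbitrary: x s)
  case 0
  then show ?case using kernel_app_const[OF M 0] by (simp add: paths_0 path_weight_def)
next
  case (Suc n)
  have "(\<Sum>ys\<in>paths d (Suc n). path_weight M (x # ys) * (\<Prod>t<Suc (Suc n). h (s + t) ((x # ys) ! t)))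
    = (\<Sum>y<d. \<Sum>zs\<in>paths d n. h s x * (M $$ (x, y) *
        (path_weight M (y # zs) * (\<Prod>t<Suc n. h (Suc s + t) ((y # zs) ! t)))))"
    unfolding sum_paths_Suc path_weight_Cons_Cons
    by (intro sum.cong refl) (simp add: prod.lessThan_Suc_shift mult_ac del: prod.lessThan_Suc)
  also have "\<dots> = (\<Sum>y<d. h s x * (M $$ (x, y) * backward d M h (Suc n) (Suc s) y))"
    unfolding sum_distrib_left[symmetric] 
    by (intro arg_cong[where f = "(*) (h s x)"] sum.cong refl arg_cong[where f = "(*) (M $$ (x, _))"] Suc.IH) simp
  also have "\<dots> = h s x * app d M (backward d M h (Suc n) (Suc s)) x"
    by (simp only: app_def sum_distrib_left)
  finally show ?case by (simp only: backward.simps(2)[of d M h "Suc n" s])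
qed

lemma sum_paths_expectation:
  assumes M: "kernel M"
  shows "(\<Sum>xs\<in>paths d (Suc n). \<nu> (xs ! 0) * path_weight M xs * (\<Prod>t<Suc n. h t (xs ! t)))
    = (\<Sum>x<d. \<nu> x * backward d M h (Suc n) 0 x)"
proof -
  have "(\<Sum>xs\<in>paths d (Suc n). \<nu> (xs ! 0) * path_weight M xs * (\<Prod>t<Suc n. h t (xs ! t)))
    = (\<Sum>x<d. \<nu> x * (\<Sum>ys\<in>paths d n. path_weight M (x # ys) * (\<Prod>t<Suc n. h (0 + t) ((x # ys) ! t))))"
    unfolding sum_paths_Suc sum_distrib_left by (simp add: mult.assoc del: prod.lessThan_Suc)
  also have "\<dots> = (\<Sum>x<d. \<nu> x * backward d M h (Suc n) 0 x)"
    using sum_paths_backward[OF M, where s = 0 and n = n and h = h] by (intro sum.cong refl) (simp del: prod.lessThan_Suc backward.simps)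
  finally show ?thesis .
qed

lemma backward_trivial:
  assumes M: "kernel M" and x: "x < d"
    and h: "\<And>t. s \<le> t \<Longrightarrow> t < s + n \<Longrightarrow> h t = (\<lambda>_. 1)"
  shows "backward d M h n s x = 1"
  using x h
proof (induction n arbitrary: s x)
  case (Suc n)
  have "app d M (backward d M h n (Suc s)) x = app d M (\<lambda>_. 1) x"
    using Suc by (intro app_cong) auto
  then show ?case using Suc.prems kernel_app_const[OF M] by simp
qed simp

lemma backward_skip:
  assumes M: "kernel M" and x: "x < d"
    and h: "\<And>t. s \<le> t \<Longrightarrow> t < s + r \<Longrightarrow> h t = (\<lambda>_. 1)"
  shows "backward d M h n s x = app d (M ^\<^sub>m r) (backward d M h (n - r) (s + r)) x"
  using x h
proof (induction r arbitrary: n s x)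
  case 0
  have "M ^\<^sub>m 0 = 1\<^sub>m d" using kernel_carrier[OF M] by simp
  then show ?case using 0 by (simp add: app_one)
next
  case (Suc r)
  show ?case
  proof (cases n)
    case 0
    then show ?thesis using kernel_app_const[OF kernel_pow[OF M, of "Suc r"] Suc.prems(1), of 1]
      by (simp del: pow_mat.simps)
  next
    case n: (Suc n')
    have "backward d M h n s x = app d M (backward d M h n' (Suc s)) x"
      using Suc.prems(2)[of s] by (simp add: n)
    also have "\<dots> = app d M (app d (M ^\<^sub>m r) (backward d M h (n' - r) (Suc s + r))) x"
      using Suc.prems(2) by (intro app_cong Suc.IH) auto
    also have "\<dots> = app d (M ^\<^sub>m Suc r) (backward d M h (n' - r) (Suc s + r)) x"
      by (rule app_pow_Suc[OF kernel_carrier[OF M] Suc.prems(1), symmetric])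
    finally show ?thesis by (simp add: n)
  qed
qed

text \<open>
  Between consecutive sampled times the recursion is \<open>k\<close> plain steps, so each sampled time in the
  horizon contributes one application of the tilted kernel \<open>M\<^sup>k H\<close>; there are \<open>\<lceil>n / k\<rceil>\<close> of them when
  the first is \<open>s\<close> itself.
\<close>

lemma sampled_backward_norm:
  assumes M: "kernel M" and k: "1 \<le> k" and \<Lambda>: "0 \<le> \<Lambda>"
    and norm: "\<And>v. ip (app d (M ^\<^sub>m k) (\<lambda>x. tilt y i x * v x)) (app d (M ^\<^sub>m k) (\<lambda>x. tilt y i x * v x))
                 \<le> \<Lambda> * ip v v"
    and s: "s mod k = j"
  defines "b \<equiv> backward d M (sampled_tilt k j y i)"
  shows "ip (app d (M ^\<^sub>m k) (b n s)) (app d (M ^\<^sub>m k) (b n s)) \<le> \<Lambda> ^ ((n + k - 1) div k)"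
  using s
proof (induction n arbitrary: s rule: less_induct)
  case (less n)
  let ?K = "M ^\<^sub>m k"
  note K = kernel_pow[OF M, of k]
  obtain k' where k': "k = Suc k'" using k by (cases k) auto
  show ?case
  proof (cases n)
    case 0
    have "ip (app d ?K (b n s)) (app d ?K (b n s)) = ip (\<lambda>_. 1) (\<lambda>_. 1)"
      using kernel_app_const[OF K] by (intro ip_cong) (auto simp: b_def 0)
    then show ?thesis using k by (simp add: ip_one_one 0)
  next
    case n: (Suc n')
    define v where "v = app d ?K (b (n - k) (s + k))"
    have triv: "sampled_tilt k j y i t = (\<lambda>_. 1)" if "Suc s \<le> t" "t < Suc s + k'" for t
    proof -
      have "t mod k \<noteq> s mod k"
      proof
        assume "t mod k = s mod k"
        then have "k dvd t - s" using that by (simp add: mod_eq_dvd_iff_nat)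
        then have "k \<le> t - s" by (rule dvd_imp_le) (use that in simp)
        then show False using that k' by simp
      qed
      then show ?thesis using less.prems by (simp add: sampled_tilt_def)
    qed
    have step: "b n s x = tilt y i x * v x" if "x < d" for x
    proof -
      have "b n s x = tilt y i x * app d M (b n' (Suc s)) x"
        using less.prems unfolding b_def n backward.simps by (simp add: sampled_tilt_def)
      also have "app d M (b n' (Suc s)) x = app d M (app d (M ^\<^sub>m k') (b (n' - k') (Suc s + k'))) x"
        unfolding b_def by (intro app_cong backward_skip M triv)
      also have "\<dots> = app d (M ^\<^sub>m Suc k') (b (n' - k') (Suc s + k')) x"
        by (rule app_pow_Suc[OF kernel_carrier[OF M] that, symmetric])
      finally show ?thesis by (simp add: v_def n k')
    qed
    have "ip (app d ?K (b n s)) (app d ?K (b n s)) =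
        ip (app d ?K (\<lambda>x. tilt y i x * v x)) (app d ?K (\<lambda>x. tilt y i x * v x))"
      by (intro ip_cong app_cong step)
    also have "\<dots> \<le> \<Lambda> * ip v v" by (rule norm)
    also have "\<dots> \<le> \<Lambda> * \<Lambda> ^ ((n - k + k - 1) div k)"
      unfolding v_def using \<Lambda> less.prems k n by (intro mult_left_mono less.IH) auto
    also have "\<dots> = \<Lambda> ^ Suc ((n - k + k - 1) div k)" by simp
    also have "Suc ((n - k + k - 1) div k) = (n + k - 1) div k"
    proof (cases "k \<le> n")
      case True
      then obtain r where "n = r + k" by (metis le_add_diff_inverse2)
      then have "n - k + k - 1 = r + k'" "n + k - 1 = (r + k') + k" by (simp_all add: k')
      then show ?thesis using k by (simp only: div_add_self2)
    next
      case False
      then have "n - k + k - 1 = k'" "n + k - 1 = n' + k" "n' < k" by (simp_all add: k' n)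
      moreover have "k' div k = 0" by (simp add: k')
      ultimately show ?thesis using k by (simp only: div_add_self2) simp
    qed
    finally show ?thesis .
  qed
qed

text \<open>
  By stationarity the \<open>j\<close> untilted steps before the first sampled time change nothing, and \<open>k\<close> more
  steps may be inserted in front of it. What remains is a mean, bounded by the norm.
\<close>

lemma sampled_expectation:
  assumes M: "kernel M" and k: "1 \<le> k" and j: "j < k" and \<Lambda>: "0 \<le> \<Lambda>"
    and norm: "\<And>v. ip (app d (M ^\<^sub>m k) (\<lambda>x. tilt y i x * v x)) (app d (M ^\<^sub>m k) (\<lambda>x. tilt y i x * v x))
                 \<le> \<Lambda> * ip v v"
  shows "(\<Sum>x<d. p x * backward d M (sampled_tilt k j y i) m 0 x) \<le> sqrt (\<Lambda> ^ ((m - j + k - 1) div k))"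
proof -
  let ?b = "backward d M (sampled_tilt k j y i)"
  let ?K = "M ^\<^sub>m k"
  have "(\<Sum>x<d. p x * ?b m 0 x) = ip (?b m 0) (\<lambda>_. 1)" by (simp add: ip_def)
  also have "\<dots> = ip (app d (M ^\<^sub>m j) (?b (m - j) (0 + j))) (\<lambda>_. 1)"
    using j by (intro ip_cong backward_skip M) (auto simp: sampled_tilt_def)
  also have "\<dots> = ip (?b (m - j) j) (\<lambda>_. 1)" using kernel_ip_one[OF kernel_pow[OF M]] by simp
  also have "\<dots> = ip (app d ?K (?b (m - j) j)) (\<lambda>_. 1)"
    using kernel_ip_one[OF kernel_pow[OF M]] by simp
  also have "\<dots> \<le> sqrt (ip (app d ?K (?b (m - j) j)) (app d ?K (?b (m - j) j)))"
    by (intro real_le_rsqrt mean_square_le)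
  also have "\<dots> \<le> sqrt (\<Lambda> ^ ((m - j + k - 1) div k))"
    using j by (intro real_sqrt_le_mono sampled_backward_norm M k \<Lambda> norm) auto
  finally show ?thesis .
qed

end

section \<open>Concentration of the number of visits\<close>

lemma exp_average_le:
  fixes a :: "nat \<Rightarrow> real"
  assumes "1 \<le> k"
  shows "exp ((\<Sum>j<k. a j) / real k) \<le> (\<Sum>j<k. exp (a j)) / real k"
proof -
  have "exp (\<Sum>j<k. (1 / real k) *\<^sub>R a j) \<le> (\<Sum>j<k. (1 / real k) * exp (a j))"
    using assms by (intro convex_on_sum[OF _ _ exp_convex]) (auto simp: lessThan_empty_iff)
  then show ?thesis by (simp add: sum_divide_distrib)
qed

lemma count_list_eq_card: "count_list xs i = card {t. t < length xs \<and> xs ! t = i}"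
proof -
  have "count_list xs i = length (filter (\<lambda>x. x = i) xs)"
    by (induction xs) auto
  then show ?thesis by (simp add: length_filter_conv_card)
qed

lemma prod_sampled_tilt:
  "(\<Prod>t<m. sampled_tilt k j y i t (xs ! t)) = y ^ card {t. t < m \<and> xs ! t = i \<and> t mod k = j}"
proof -
  have "(\<Prod>t<m. sampled_tilt k j y i t (xs ! t)) =
      (\<Prod>t<m. if t \<in> {t. xs ! t = i \<and> t mod k = j} then y else 1)"
    by (intro prod.cong) (auto simp: sampled_tilt_def tilt_def)
  also have "\<dots> = y ^ card ({..<m} \<inter> {t. xs ! t = i \<and> t mod k = j})"
    by (subst prod.If_cases) auto
  also have "{..<m} \<inter> {t. xs ! t = i \<and> t mod k = j} = {t. t < m \<and> xs ! t = i \<and> t mod k = j}"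
    by auto
  finally show ?thesis .
qed

lemma sum_residue_counts:
  assumes "1 \<le> k"
  shows "(\<Sum>j<k. card {t. t < length xs \<and> xs ! t = i \<and> t mod k = j}) = count_list xs i"
proof -
  let ?S = "{t. t < length xs \<and> xs ! t = i}"
  have "(\<Sum>j<k. sum (\<lambda>_. 1) {t \<in> ?S. t mod k = j}) = sum (\<lambda>_. 1::nat) ?S"
    using assms by (intro sum.group) auto
  then show ?thesis by (simp add: count_list_eq_card conj_assoc)
qed

text \<open>
  The quotient is the number of times below \<open>m\<close> that are congruent to \<open>j\<close> modulo \<open>k\<close>.
\<close>

lemma residue_class_size:
  assumes "j < k"
  shows "\<bar>real ((m - j + k - 1) div k) - real m / real k\<bar> \<le> 1"
proof -
  let ?n = "(m - j + k - 1) div k"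
  have k: "0 < real k" using assms by simp
  have "?n * k \<le> m + k - 1" "m < ?n * k + k"
  proof -
    have "?n * k \<le> m - j + k - 1" by simp
    also have "\<dots> \<le> m + k - 1" by (intro diff_le_mono add_le_mono) auto
    finally show "?n * k \<le> m + k - 1" .
    have "m - j + k - 1 < ?n * k + k"
      using dividend_less_div_times[of k "m - j + k - 1"] assms by simp
    then show "m < ?n * k + k" using assms by linarith
  qed
  then have "real ?n * real k \<le> real m + real k" "real m \<le> real ?n * real k + real k"
    using assms by (simp_all flip: of_nat_mult of_nat_add)
  then have "real ?n \<le> real m / real k + 1" "real m / real k \<le> real ?n + 1"
    using k by (simp_all add: field_simps)
  then show ?thesis by linarith
qed

context prob_weights
begin

lemma p_le_1: "i < d \<Longrightarrow> p i \<le> 1"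
  using member_le_sum[of i "{..<d}" p] p_pos p_sum by (auto simp: less_imp_le)

lemma path_weight_nonneg:
  assumes "kernel M" "xs \<in> paths d m"
  shows "0 \<le> path_weight M xs"
proof -
  have "xs ! t < d" if "t < length xs" for t
    using assms(2) that by (intro paths_nth[OF assms(2)]) (simp add: paths_def)
  then show ?thesis unfolding path_weight_def
    by (intro prod_nonneg ballI kernel_nonneg assms) auto
qed

text \<open>
  The factor \<open>1 + u\<close> is raised to the power \<open>N / (2 k)\<close>: the exponent \<open>N / k\<close> is the average of the
  visit counts over the \<open>k\<close> residue classes, so that convexity reduces to a single class, and the
  factor 2 arises because the norm estimate bounds squares. Class sizes differ from \<open>m / k\<close> by at most
  one, which costs the constant \<open>1 / 2\<close> in the exponent.
\<close>

lemma occupation_mgf: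
  assumes M: "kernel M" and d2: "2 \<le> d" and i: "i < d" and m: "1 \<le> m" and k: "1 \<le> k"
    and g: "0 < g" "g \<le> 1" and u: "\<bar>u\<bar> \<le> g / 2"
    and gap: "\<And>f. ip f (\<lambda>_. 1) = 0 \<Longrightarrow>
       ip (app d (M ^\<^sub>m k) f) (app d (M ^\<^sub>m k) f) \<le> (1 - g) * ip f f"
  shows "(\<Sum>xs\<in>paths d m. p (xs ! 0) * path_weight M xs * exp (ln (1 + u) * count_list xs i / (2 * real k)))
    \<le> exp (1 / 2 + p i * (u + 2 * u\<^sup>2 / g) * real m / (2 * real k))"
proof -
  define y where "y = sqrt (1 + u)"
  have u1: "0 < 1 + u" using u g by linarith
  have y: "0 < y" "y\<^sup>2 = 1 + u" using u1 by (simp_all add: y_def)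
  have ypow: "exp (ln (1 + u) / 2 * real n) = y ^ n" for n
  proof -
    have "exp (ln (1 + u) / 2) = y" using u1 y(1) by (simp add: y_def flip: ln_sqrt)
    then show ?thesis by (simp only: exp_of_nat2_mult)
  qed
  define b where "b = p i * (u + 2 * u\<^sup>2 / g)"
  define \<Lambda> where "\<Lambda> = 1 + b"
  have b1: "\<bar>b\<bar> \<le> 1"
  proof -
    have "\<bar>u\<bar> * \<bar>u\<bar> \<le> \<bar>u\<bar> * (g / 2)" using u by (intro mult_left_mono) auto
    then have "2 * u\<^sup>2 / g \<le> \<bar>u\<bar>" using g by (simp add: field_simps power2_eq_square)
    moreover have "0 \<le> 2 * u\<^sup>2 / g" using g by simp
    ultimately have "\<bar>u + 2 * u\<^sup>2 / g\<bar> \<le> 1" using u g by linarith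
    then show ?thesis unfolding b_def abs_mult
      using p_le_1[OF i] p_pos[OF i] by (intro mult_le_one) auto
  qed
  have \<Lambda>: "0 \<le> \<Lambda>" using b1 by (simp add: \<Lambda>_def)
  have \<Lambda>_eq: "1 + (u * p i + 2 * u\<^sup>2 * p i / g) = \<Lambda>"
    by (simp add: \<Lambda>_def b_def algebra_simps)
  note norm = tilted_kernel_norm[OF kernel_pow[OF M] d2 i g u y(2) gap, unfolded \<Lambda>_eq]
  define N where "N j xs = card {t. t < m \<and> xs ! t = i \<and> t mod k = j}" for j xs
  have avg: "exp (ln (1 + u) * count_list xs i / (2 * real k)) \<le> (\<Sum>j<k. y ^ N j xs) / real k"
    if "xs \<in> paths d m" for xs
  proof -
    have "real (count_list xs i) = (\<Sum>j<k. real (N j xs))"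
    proof -
      have "length xs = m" using that by (simp add: paths_def)
      then show ?thesis using sum_residue_counts[OF k, of xs i]
        by (simp add: N_def flip: of_nat_sum)
    qed
    then have "ln (1 + u) * count_list xs i / (2 * real k) = (\<Sum>j<k. ln (1 + u) / 2 * real (N j xs)) / real k"
      unfolding sum_distrib_left[symmetric] by simp
    then show ?thesis using exp_average_le[OF k, of "\<lambda>j. ln (1 + u) / 2 * real (N j xs)"]
      by (simp only: ypow)
  qed
  have each: "(\<Sum>xs\<in>paths d m. p (xs ! 0) * path_weight M xs * y ^ N j xs)
      \<le> exp (1 / 2 + b * real m / (2 * real k))" if "j < k" for j
  proof -
    obtain m' where m': "m = Suc m'" using m by (cases m) auto
    let ?n = "(m - j + k - 1) div k"
    have "(\<Sum>xs\<in>paths d m. p (xs ! 0) * path_weight M xs * y ^ N j xs)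
        = (\<Sum>xs\<in>paths d m. p (xs ! 0) * path_weight M xs * (\<Prod>t<m. sampled_tilt k j y i t (xs ! t)))"
      unfolding prod_sampled_tilt N_def ..
    also have "\<dots> = (\<Sum>x<d. p x * backward d M (sampled_tilt k j y i) m 0 x)"
      unfolding m' by (rule sum_paths_expectation[OF M])
    also have "\<dots> \<le> sqrt (\<Lambda> ^ ?n)"
      by (rule sampled_expectation[OF M k that \<Lambda> norm])
    also have "\<dots> \<le> exp (1 / 2 + b * real m / (2 * real k))"
    proof (rule real_le_lsqrt)
      have "\<Lambda> ^ ?n \<le> exp b ^ ?n" using \<Lambda> exp_ge_add_one_self[of b] by (intro power_mono) (auto simp: \<Lambda>_def)
      also have "\<dots> = exp (real ?n * b)" by (simp add: exp_of_nat_mult)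
      also have "\<dots> \<le> exp (1 + b * real m / real k)"
      proof -
        have "(real ?n - real m / real k) * b \<le> \<bar>real ?n - real m / real k\<bar> * \<bar>b\<bar>"
          unfolding abs_mult[symmetric] by (rule abs_ge_self)
        also have "\<dots> \<le> 1" using residue_class_size[OF that] b1 by (intro mult_le_one) auto
        finally show ?thesis by (simp add: algebra_simps)
      qed
      also have "\<dots> = (exp (1 / 2 + b * real m / (2 * real k)))\<^sup>2"
        by (simp add: power2_eq_square flip: exp_add)
      finally show "\<Lambda> ^ ?n \<le> (exp (1 / 2 + b * real m / (2 * real k)))\<^sup>2" .
    qed simp
    finally show ?thesis .
  qed
  have "(\<Sum>xs\<in>paths d m. p (xs ! 0) * path_weight M xs * exp (ln (1 + u) * count_list xs i / (2 * real k)))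
    \<le> (\<Sum>xs\<in>paths d m. p (xs ! 0) * path_weight M xs * ((\<Sum>j<k. y ^ N j xs) / real k))"
  proof (intro sum_mono mult_left_mono avg)
    fix xs assume xs: "xs \<in> paths d m"
    then have "xs ! 0 < d" using m by (intro paths_nth) auto
    then show "0 \<le> p (xs ! 0) * path_weight M xs"
      using p_pos path_weight_nonneg[OF M xs] by (simp add: less_imp_le)
  qed
  also have "\<dots> = (\<Sum>j<k. \<Sum>xs\<in>paths d m. p (xs ! 0) * path_weight M xs * y ^ N j xs) / real k"
    by (subst sum.swap) (simp add: sum_distrib_left sum_divide_distrib)
  also have "\<dots> \<le> (\<Sum>j<k. exp (1 / 2 + b * real m / (2 * real k))) / real k"
    using each by (intro divide_right_mono sum_mono) auto
  also have "\<dots> = exp (1 / 2 + b * real m / (2 * real k))" using k by simp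
  finally show ?thesis by (simp add: b_def)
qed

text \<open>
  Markov's inequality applied to the exponential moment, for the upper (\<open>\<sigma> = 1\<close>) and lower
  (\<open>\<sigma> = -1\<close>) deviation at once. The tilt \<open>u\<close> carries the sign of the deviation; its size
  \<open>\<epsilon> g / 8\<close> makes the linear gain \<open>\<epsilon> \<bar>u\<bar>\<close> exceed the quadratic losses, which are of order
  \<open>u\<^sup>2 / g\<close>.
\<close>

lemma occupation_tail:
  assumes M: "kernel M" and d2: "2 \<le> d" and i: "i < d" and m: "1 \<le> m" and k: "1 \<le> k"
    and g: "0 < g" "g \<le> 1" and \<epsilon>: "0 < \<epsilon>" "\<epsilon> < 1" and \<sigma>: "\<sigma> = 1 \<or> \<sigma> = - 1"
    and gap: "\<And>f. ip f (\<lambda>_. 1) = 0 \<Longrightarrow>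
       ip (app d (M ^\<^sub>m k) f) (app d (M ^\<^sub>m k) f) \<le> (1 - g) * ip f f"
  shows "(\<Sum>xs | xs \<in> paths d m \<and> \<sigma> * (real (count_list xs i) - real m * p i) \<ge> \<epsilon> * (real m * p i).
            p (xs ! 0) * path_weight M xs)
    \<le> exp (1 / 2 - real m * p i * \<epsilon>\<^sup>2 * g / (64 * real k))"
proof -
  define u where "u = \<sigma> * \<epsilon> * g / 8"
  have u_abs: "\<bar>u\<bar> = \<epsilon> * g / 8" using \<sigma> \<epsilon> g by (auto simp: u_def abs_mult)
  have \<epsilon>g: "\<epsilon> * g \<le> g" using \<epsilon> g by (simp add: mult_left_le_one_le)
  have u: "\<bar>u\<bar> \<le> g / 2" unfolding u_abs using \<epsilon>g g by linarith
  define T where "T = {xs. xs \<in> paths d m \<and> \<sigma> * (real (count_list xs i) - real m * p i) \<ge> \<epsilon> * (real m * p i)}"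
  have T: "T \<subseteq> paths d m" "finite T" using finite_paths by (auto simp: T_def)
  \<comment> \<open>A lower bound for the exponent on the deviation event, with \<open>ln (1 + u)\<close> replaced by \<open>u - 2 u\<^sup>2\<close>.\<close>
  define c where "c = (1 + \<sigma> * \<epsilon>) * (real m * p i) * (u - 2 * u\<^sup>2) / (2 * real k)"
  have mp: "0 \<le> real m * p i" using p_pos[OF i] by simp
  have \<sigma>\<epsilon>: "0 \<le> 1 + \<sigma> * \<epsilon>" "1 + \<sigma> * \<epsilon> \<le> 2" using \<sigma> \<epsilon> by auto
  have k0: "0 < real k" using k by simp
  have lnu: "u - 2 * u\<^sup>2 \<le> ln (1 + u)"
    using abs_ln_one_plus_x_minus_x_bound[of u] u g by linarith
  have ge1: "1 \<le> exp (ln (1 + u) * count_list xs i / (2 * real k) - c)" if "xs \<in> T" for xs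
  proof -
    have "ln (1 + u) * ((1 + \<sigma> * \<epsilon>) * (real m * p i)) \<le> ln (1 + u) * real (count_list xs i)"
      using \<sigma>
    proof
      assume s: "\<sigma> = 1"
      then have "0 \<le> u" using \<epsilon> g by (simp add: u_def)
      then have "0 \<le> ln (1 + u)" by simp
      then show ?thesis using that s by (intro mult_left_mono) (auto simp: T_def algebra_simps)
    next
      assume s: "\<sigma> = - 1"
      then have "u \<le> 0" using \<epsilon> g by (simp add: u_def)
      moreover have "0 < 1 + u" using u g by linarith
      ultimately have "ln (1 + u) \<le> 0" by simp
      then show ?thesis using that s by (intro mult_left_mono_neg) (auto simp: T_def algebra_simps)
    qed
    moreover have "(u - 2 * u\<^sup>2) * ((1 + \<sigma> * \<epsilon>) * (real m * p i)) \<le> ln (1 + u) * ((1 + \<sigma> * \<epsilon>) * (real m * p i))"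
      using lnu \<sigma>\<epsilon> mp by (intro mult_right_mono) auto
    ultimately have "(u - 2 * u\<^sup>2) * ((1 + \<sigma> * \<epsilon>) * (real m * p i)) \<le> ln (1 + u) * real (count_list xs i)"
      by linarith
    then have "(u - 2 * u\<^sup>2) * ((1 + \<sigma> * \<epsilon>) * (real m * p i)) / (2 * real k)
        \<le> ln (1 + u) * real (count_list xs i) / (2 * real k)"
      using k0 by (intro divide_right_mono) auto
    then show ?thesis by (simp add: c_def mult_ac)
  qed
  have nn: "0 \<le> p (xs ! 0) * path_weight M xs" if xs: "xs \<in> paths d m" for xs
  proof -
    have "xs ! 0 < d" using m by (intro paths_nth[OF xs]) auto
    then show ?thesis using p_pos path_weight_nonneg[OF M xs] by (simp add: less_imp_le)
  qed
  have "(\<Sum>xs\<in>T. p (xs ! 0) * path_weight M xs)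
      \<le> (\<Sum>xs\<in>T. p (xs ! 0) * path_weight M xs * exp (ln (1 + u) * count_list xs i / (2 * real k) - c))"
  proof (intro sum_mono)
    fix xs assume xs: "xs \<in> T"
    then have "0 \<le> p (xs ! 0) * path_weight M xs" using T(1) by (intro nn) auto
    from mult_left_mono[OF ge1[OF xs] this]
    show "p (xs ! 0) * path_weight M xs
        \<le> p (xs ! 0) * path_weight M xs * exp (ln (1 + u) * count_list xs i / (2 * real k) - c)"
      by simp
  qed
  also have "\<dots> \<le> (\<Sum>xs\<in>paths d m. p (xs ! 0) * path_weight M xs * exp (ln (1 + u) * count_list xs i / (2 * real k) - c))"
    using nn T finite_paths by (intro sum_mono2) auto
  also have "\<dots> = exp (- c) * (\<Sum>xs\<in>paths d m. p (xs ! 0) * path_weight M xs * exp (ln (1 + u) * count_list xs i / (2 * real k)))"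
    by (simp add: sum_distrib_left exp_diff exp_minus field_simps)
  also have "\<dots> \<le> exp (- c) * exp (1 / 2 + p i * (u + 2 * u\<^sup>2 / g) * real m / (2 * real k))"
    by (intro mult_left_mono occupation_mgf[OF M d2 i m k g u gap]) auto
  also have "\<dots> = exp (1 / 2 + real m * p i / (2 * real k) * (u + 2 * u\<^sup>2 / g - (1 + \<sigma> * \<epsilon>) * (u - 2 * u\<^sup>2)))"
  proof -
    have "c = real m * p i / (2 * real k) * ((1 + \<sigma> * \<epsilon>) * (u - 2 * u\<^sup>2))"
      by (simp add: c_def mult_ac)
    moreover have "p i * (u + 2 * u\<^sup>2 / g) * real m / (2 * real k)
        = real m * p i / (2 * real k) * (u + 2 * u\<^sup>2 / g)"
      by (simp add: mult_ac)
    ultimately have "- c + (1 / 2 + p i * (u + 2 * u\<^sup>2 / g) * real m / (2 * real k)) =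
        1 / 2 + real m * p i / (2 * real k) * (u + 2 * u\<^sup>2 / g - (1 + \<sigma> * \<epsilon>) * (u - 2 * u\<^sup>2))"
      unfolding right_diff_distrib[of "real m * p i / (2 * real k)"] by linarith
    then show ?thesis by (simp only: exp_add[symmetric])
  qed
  also have "\<dots> \<le> exp (1 / 2 + real m * p i / (2 * real k) * (- (\<epsilon>\<^sup>2 * g / 32)))"
  proof -
    have \<sigma>2: "\<sigma> * \<sigma> = 1" using \<sigma> by auto
    have u2: "u\<^sup>2 = \<epsilon>\<^sup>2 * g\<^sup>2 / 64"
      using \<sigma>2 by (simp add: u_def power2_eq_square algebra_simps)
    have "(1 + \<sigma> * \<epsilon>) * (u - 2 * u\<^sup>2) = u + \<sigma> * u * \<epsilon> - (1 + \<sigma> * \<epsilon>) * (2 * u\<^sup>2)"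
      by (simp add: algebra_simps)
    moreover have "2 * u\<^sup>2 / g = \<epsilon>\<^sup>2 * g / 32" using g unfolding u2 by (simp add: power2_eq_square)
    moreover have "\<sigma> * u * \<epsilon> = \<epsilon>\<^sup>2 * g / 8"
    proof -
      have "\<sigma> * u * \<epsilon> = (\<sigma> * \<sigma>) * \<epsilon>\<^sup>2 * g / 8" by (simp add: u_def power2_eq_square)
      then show ?thesis using \<sigma>2 by simp
    qed
    moreover have "(1 + \<sigma> * \<epsilon>) * (2 * u\<^sup>2) \<le> \<epsilon>\<^sup>2 * g / 16"
    proof -
      have "(1 + \<sigma> * \<epsilon>) * (2 * u\<^sup>2) \<le> 2 * (2 * u\<^sup>2)" using \<sigma>\<epsilon> by (intro mult_right_mono) auto
      moreover have "\<epsilon>\<^sup>2 * (g * g) \<le> \<epsilon>\<^sup>2 * g" using g by (intro mult_left_mono) (auto simp: mult_left_le)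
      ultimately show ?thesis unfolding u2 by (simp add: power2_eq_square)
    qed
    ultimately have "u + 2 * u\<^sup>2 / g - (1 + \<sigma> * \<epsilon>) * (u - 2 * u\<^sup>2) \<le> - (\<epsilon>\<^sup>2 * g / 32)" by linarith
    then have "real m * p i / (2 * real k) * (u + 2 * u\<^sup>2 / g - (1 + \<sigma> * \<epsilon>) * (u - 2 * u\<^sup>2))
        \<le> real m * p i / (2 * real k) * (- (\<epsilon>\<^sup>2 * g / 32))"
      using mp k0 by (intro mult_left_mono) auto
    then show ?thesis by simp
  qed
  also have "1 / 2 + real m * p i / (2 * real k) * (- (\<epsilon>\<^sup>2 * g / 32)) = 1 / 2 - real m * p i * \<epsilon>\<^sup>2 * g / (64 * real k)"
    by simp
  finally show ?thesis by (simp add: T_def)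
qed

end

section \<open>Estimating the minimum stationary probability\<close>

lemma Min_relative_error:
  fixes a b :: "nat \<Rightarrow> real"
  assumes "finite I" "I \<noteq> {}" "\<epsilon> < 1" "0 < \<epsilon>"
    and lo: "\<And>i. i \<in> I \<Longrightarrow> (1 - \<epsilon>) * b i < a i"
    and i0: "i0 \<in> I" "b i0 = Min (b ` I)" and hi: "a i0 < (1 + \<epsilon>) * b i0"
  shows "\<bar>Min (a ` I) - Min (b ` I)\<bar> < \<epsilon> * Min (b ` I)"
proof -
  have "Min (a ` I) \<le> a i0" using assms by (intro Min_le) auto
  moreover have "(1 - \<epsilon>) * Min (b ` I) < Min (a ` I)"
  proof (subst Min_gr_iff)
    show "\<forall>x\<in>a ` I. (1 - \<epsilon>) * Min (b ` I) < x"
    proof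
      fix x assume "x \<in> a ` I"
      then obtain i where i: "i \<in> I" "x = a i" by auto
      have "Min (b ` I) \<le> b i" using i assms by (intro Min_le) auto
      then have "(1 - \<epsilon>) * Min (b ` I) \<le> (1 - \<epsilon>) * b i" using assms by (intro mult_left_mono) auto
      then show "(1 - \<epsilon>) * Min (b ` I) < x" using lo[OF i(1)] i by simp
    qed
  qed (use assms in auto)
  ultimately show ?thesis using hi i0 by (simp add: algebra_simps abs_less_iff)
qed

text \<open>
  Stationarity for \<open>M\<close> implies stationarity for its powers, one of which moves mass from every state
  to every other.
\<close>

lemma ergodic_stationary_positive:
  assumes "row_stochastic d M" "ergodic d M" "stationary d M \<pi>" "j < d"
  shows "0 < pmf \<pi> j"
proof -
  have Mc: "M \<in> carrier_mat d d" using assms by (simp add: row_stochastic_def)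
  obtain k where k: "\<And>i j. i < d \<Longrightarrow> j < d \<Longrightarrow> 0 < (M ^\<^sub>m k) $$ (i, j)"
    using assms(2) by (auto simp: ergodic_def)
  have st: "(\<Sum>i<d. pmf \<pi> i * M $$ (i, j)) = pmf \<pi> j" if "j < d" for j
    using assms(3) that by (auto simp: stationary_def)
  have stk: "(\<Sum>i<d. pmf \<pi> i * (M ^\<^sub>m k) $$ (i, j)) = pmf \<pi> j" if "j < d" for k j
    using that
  proof (induction k arbitrary: j)
    case 0
    then show ?case using Mc by (simp add: if_distrib[of "\<lambda>x. _ * x"] cong: if_cong)
  next
    case (Suc k)
    have "(\<Sum>i<d. pmf \<pi> i * (M ^\<^sub>m Suc k) $$ (i, j))
        = (\<Sum>i<d. \<Sum>l<d. pmf \<pi> i * (M ^\<^sub>m k) $$ (i, l) * M $$ (l, j))"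
      using Suc.prems Mc by (intro sum.cong refl)
        (simp add: mult_entry[of "M ^\<^sub>m k" d M] sum_distrib_left mult.assoc del: index_mult_mat)
    also have "\<dots> = (\<Sum>l<d. (\<Sum>i<d. pmf \<pi> i * (M ^\<^sub>m k) $$ (i, l)) * M $$ (l, j))"
      unfolding sum_distrib_right by (rule sum.swap)
    also have "\<dots> = (\<Sum>l<d. pmf \<pi> l * M $$ (l, j))"
      using Suc.IH by (intro sum.cong refl) simp
    finally show ?case using st[OF Suc.prems] by simp
  qed
  have "(\<Sum>i<d. pmf \<pi> i) = 1"
    using assms(3) by (intro sum_pmf_eq_1) (auto simp: stationary_def)
  then obtain i where i: "i < d" "0 < pmf \<pi> i"
    by (metis (no_types, lifting) lessThan_iff pmf_nonneg not_less order_antisym sum.neutral zero_neq_one)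
  have "0 < pmf \<pi> i * (M ^\<^sub>m k) $$ (i, j)" using i k assms(4) by simp
  also have "\<dots> \<le> (\<Sum>i<d. pmf \<pi> i * (M ^\<^sub>m k) $$ (i, j))"
    using i k assms(4) by (intro member_le_sum) (auto simp: less_imp_le)
  also have "\<dots> = pmf \<pi> j" by (rule stk[OF assms(4)])
  finally show ?thesis .
qed

context prob_weights
begin

text \<open>
  The prescribed probabilities of paths add up to one, which is the expectation of an empty product,
  so no mass is left for other lists.
\<close>

lemma trajectory_law_paths:
  assumes M: "kernel M" and \<mu>: "set_pmf \<mu> \<subseteq> {..<d}" and m: "1 \<le> m"
    and P: "trajectory_law d M \<mu> m P"
  shows "xs \<in> paths d m \<Longrightarrow> pmf P xs = pmf \<mu> (xs ! 0) * path_weight M xs"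
    and "measure_pmf.prob P (paths d m) = 1"
proof -
  show pm: "pmf P xs = pmf \<mu> (xs ! 0) * path_weight M xs" if "xs \<in> paths d m" for xs
    using P that by (auto simp: trajectory_law_def paths_def path_weight_def)
  obtain m' where m': "m = Suc m'" using m by (cases m) auto
  let ?h = "\<lambda>_ _. 1 :: real"
  have "measure_pmf.prob P (paths d m) = (\<Sum>xs\<in>paths d m. pmf \<mu> (xs ! 0) * path_weight M xs * (\<Prod>t<m. ?h t (xs ! t)))"
    using pm by (simp add: measure_measure_pmf_finite[OF finite_paths])
  also have "\<dots> = (\<Sum>x<d. pmf \<mu> x * backward d M ?h m 0 x)"
    unfolding m' by (rule sum_paths_expectation[OF M])
  also have "\<dots> = (\<Sum>x<d. pmf \<mu> x)"
    using backward_trivial[OF M, where h = ?h] by (intro sum.cong refl) simp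
  also have "\<dots> = 1" using \<mu> by (intro sum_pmf_eq_1) auto
  finally show "measure_pmf.prob P (paths d m) = 1" .
qed

text \<open>
  Since \<open>p \<ge> r\<close>, the law of a path under any start is at most \<open>1 / r\<close> times its law under the
  stationary start.
\<close>

lemma occupation_tail_any_start:
  assumes M: "kernel M" and d2: "2 \<le> d" and i: "i < d" and m: "1 \<le> m" and k: "1 \<le> k"
    and g: "0 < g" "g \<le> 1" and \<epsilon>: "0 < \<epsilon>" "\<epsilon> < 1" and \<sigma>: "\<sigma> = 1 \<or> \<sigma> = - 1"
    and gap: "\<And>f. ip f (\<lambda>_. 1) = 0 \<Longrightarrow>
       ip (app d (M ^\<^sub>m k) f) (app d (M ^\<^sub>m k) f) \<le> (1 - g) * ip f f"
    and \<mu>: "set_pmf \<mu> \<subseteq> {..<d}" and P: "trajectory_law d M \<mu> m P"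
    and r: "0 < r" "\<And>i. i < d \<Longrightarrow> r \<le> p i"
  shows "measure_pmf.prob P {xs \<in> paths d m. \<sigma> * (real (count_list xs i) - real m * p i) \<ge> \<epsilon> * (real m * p i)}
    \<le> exp (1 / 2 - real m * r * \<epsilon>\<^sup>2 * g / (64 * real k)) / r"
proof -
  define T where "T = {xs \<in> paths d m. \<sigma> * (real (count_list xs i) - real m * p i) \<ge> \<epsilon> * (real m * p i)}"
  have T: "finite T" "T \<subseteq> paths d m" using finite_paths by (auto simp: T_def)
  have "measure_pmf.prob P T = (\<Sum>xs\<in>T. pmf P xs)"
    by (rule measure_measure_pmf_finite[OF T(1)])
  also have "\<dots> \<le> (\<Sum>xs\<in>T. p (xs ! 0) * path_weight M xs / r)"
  proof (intro sum_mono)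
    fix xs assume "xs \<in> T"
    then have xs: "xs \<in> paths d m" using T by auto
    then have x0: "xs ! 0 < d" using m by (intro paths_nth) auto
    have "pmf \<mu> (xs ! 0) \<le> p (xs ! 0) / r"
      using pmf_le_1[of \<mu> "xs ! 0"] r(2)[OF x0] r(1) by (simp add: le_divide_eq)
         (metis mult_left_le_one_le order_trans pmf_nonneg less_imp_le)
    then have "pmf \<mu> (xs ! 0) * path_weight M xs \<le> p (xs ! 0) / r * path_weight M xs"
      using path_weight_nonneg[OF M xs] by (intro mult_right_mono)
    then show "pmf P xs \<le> p (xs ! 0) * path_weight M xs / r"
      using trajectory_law_paths(1)[OF M \<mu> m P xs] by simp
  qed
  also have "\<dots> = (\<Sum>xs\<in>T. p (xs ! 0) * path_weight M xs) / r"
    by (simp add: sum_divide_distrib)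
  also have "\<dots> \<le> exp (1 / 2 - real m * p i * \<epsilon>\<^sup>2 * g / (64 * real k)) / r"
    unfolding T_def using r
    by (intro divide_right_mono occupation_tail[OF M d2 i m k g \<epsilon> \<sigma> gap]) auto
  also have "\<dots> \<le> exp (1 / 2 - real m * r * \<epsilon>\<^sup>2 * g / (64 * real k)) / r"
  proof -
    have "real m * r * \<epsilon>\<^sup>2 * g / (64 * real k) \<le> real m * p i * \<epsilon>\<^sup>2 * g / (64 * real k)"
      using r(2)[OF i] g by (intro divide_right_mono mult_right_mono mult_left_mono) auto
    then show ?thesis using r(1) by (intro divide_right_mono) auto
  qed
  finally show ?thesis by (simp add: T_def)
qed

end

text \<open>
  With \<open>z = (d / \<delta>) \<surd>(1 / r)\<close>, the exponential is at most \<open>2 / z\<^sup>4 = 2 \<delta>\<^sup>4 r\<^sup>2 / d\<^sup>4\<close>, which leaves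
  room for both factors \<open>d + 1\<close> and \<open>1 / r\<close>.
\<close>

lemma union_bound_arith:
  fixes d :: nat and r \<delta> x :: real
  assumes d: "2 \<le> d" and r: "0 < r" "r \<le> 1" and \<delta>: "0 < \<delta>" "\<delta> < 1"
    and x: "4 * ln (real d / \<delta> * sqrt (inverse r)) \<le> x"
  shows "(real d + 1) * (exp (1 / 2 - x) / r) \<le> \<delta>"
proof -
  define z where "z = real d / \<delta> * sqrt (inverse r)"
  have z: "0 < z" using d r \<delta> by (simp add: z_def)
  have z4: "z ^ 4 = real d ^ 4 / (\<delta> ^ 4 * r\<^sup>2)"
  proof -
    have "sqrt (inverse r) ^ 4 = ((sqrt (inverse r))\<^sup>2)\<^sup>2" by (simp flip: power_mult)
    also have "\<dots> = 1 / r\<^sup>2" using r by (simp add: power_inverse inverse_eq_divide power_divide)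
    finally show ?thesis by (simp add: z_def power_mult_distrib power_divide)
  qed
  have "exp (1 / 2 - x) \<le> exp (1 / 2) * exp (- (4 * ln z))"
    using x by (simp add: z_def flip: exp_add)
  also have "exp (- (4 * ln z)) = 1 / z ^ 4"
  proof -
    have "exp (4 * ln z) = z ^ 4" using exp_of_nat_mult[of 4 "ln z"] z by simp
    then show ?thesis by (simp add: exp_minus inverse_eq_divide)
  qed
  also have "exp (1 / 2) * (1 / z ^ 4) \<le> 2 * (1 / z ^ 4)"
  proof (rule mult_right_mono)
    show "exp (1 / 2) \<le> (2 :: real)" using exp_bound_half[of "1 / 2 :: real"] by simp
  qed (use z in simp)
  finally have e: "exp (1 / 2 - x) \<le> 2 * (\<delta> ^ 4 * r\<^sup>2 / real d ^ 4)"
    by (simp add: z4)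
  have d0: "0 < real d" using d by simp
  have "(real d + 1) * (exp (1 / 2 - x) / r) \<le> (2 * real d) * (2 * (\<delta> ^ 4 * r\<^sup>2 / real d ^ 4) / r)"
    using e d r by (intro mult_mono divide_right_mono) auto
  also have "\<dots> = \<delta> * (4 * \<delta> ^ 3 * r / real d ^ 3)"
    using r d0 by (simp add: field_simps power2_eq_square power3_eq_cube power4_eq_xxxx)
  also have "\<dots> \<le> \<delta> * 1"
  proof (intro mult_left_mono)
    have "\<delta> ^ 3 * r \<le> 1" using \<delta> r by (intro mult_le_one power_le_one) auto
    moreover have "2 ^ 3 \<le> real d ^ 3" using d by (intro power_mono) auto
    ultimately show "4 * \<delta> ^ 3 * r / real d ^ 3 \<le> 1" using d0 by (simp add: field_simps)
  qed (use \<delta> in auto)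
  finally show ?thesis by simp
qed

text \<open>
  The constant 256 is 4, the power of the logarithm's argument consumed by the union bound, times
  the 64 in the tail exponent. For \<open>d = 1\<close> the answer 1 is known in advance; the union bound needs
  \<open>d \<ge> 2\<close>, where \<open>d / \<delta>\<close> is large enough to absorb constants.
\<close>

theorem theorem5p1:
  shows "\<exists>C::real. C > 0 \<and>
    (\<forall>d::nat. d \<ge> 1 \<longrightarrow>
      (\<exists>est :: nat \<Rightarrow> nat list \<Rightarrow> real.
        \<forall>(\<epsilon>::real) (\<delta>::real) M \<mu> \<pi> (m::nat) P.
          0 < \<epsilon> \<and> \<epsilon> < 1 \<and> 0 < \<delta> \<and> \<delta> < 1 \<and>
          markov_chain d M \<mu> \<and> ergodic d M \<and> stationary d M \<pi> \<and>
          real m \<ge> C / (pseudo_spectral_gap d \<pi> M * \<epsilon>\<^sup>2 * min_prob d \<pi>)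
                     * ln (real d / \<delta> * sqrt (inverse (min_prob d \<pi>))) \<and>
          trajectory_law d M \<mu> m P
          \<longrightarrow> measure_pmf.prob P {X. \<bar>est m X - min_prob d \<pi>\<bar> < \<epsilon> * min_prob d \<pi>} \<ge> 1 - \<delta>))"
proof (intro exI[of _ 256] conjI allI impI)
  fix d :: nat assume d1: "d \<ge> 1"
  define est where "est m X =
    (if d = 1 then 1 else Min ((\<lambda>i. real (count_list X i) / real m) ` {..<d}))" for m :: nat and X
  show "\<exists>est :: nat \<Rightarrow> nat list \<Rightarrow> real.
        \<forall>(\<epsilon>::real) (\<delta>::real) M \<mu> \<pi> (m::nat) P.
          0 < \<epsilon> \<and> \<epsilon> < 1 \<and> 0 < \<delta> \<and> \<delta> < 1 \<and>
          markov_chain d M \<mu> \<and> ergodic d M \<and> stationary d M \<pi> \<and>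
          real m \<ge> 256 / (pseudo_spectral_gap d \<pi> M * \<epsilon>\<^sup>2 * min_prob d \<pi>)
                     * ln (real d / \<delta> * sqrt (inverse (min_prob d \<pi>))) \<and>
          trajectory_law d M \<mu> m P
          \<longrightarrow> measure_pmf.prob P {X. \<bar>est m X - min_prob d \<pi>\<bar> < \<epsilon> * min_prob d \<pi>} \<ge> 1 - \<delta>"
  proof (intro exI[of _ est] allI impI, elim conjE)
    fix \<epsilon> \<delta> :: real and M :: "real mat" and \<mu> \<pi> :: "nat pmf" and m :: nat and P :: "nat list pmf"
    assume \<epsilon>: "0 < \<epsilon>" "\<epsilon> < 1" and \<delta>: "0 < \<delta>" "\<delta> < 1"
      and mc: "markov_chain d M \<mu>" and erg: "ergodic d M" and st: "stationary d M \<pi>"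
      and m: "256 / (pseudo_spectral_gap d \<pi> M * \<epsilon>\<^sup>2 * min_prob d \<pi>)
                     * ln (real d / \<delta> * sqrt (inverse (min_prob d \<pi>))) \<le> real m"
      and P: "trajectory_law d M \<mu> m P"
    let ?good = "{X. \<bar>est m X - min_prob d \<pi>\<bar> < \<epsilon> * min_prob d \<pi>}"
    have \<mu>: "set_pmf \<mu> \<subseteq> {..<d}" and rs: "row_stochastic d M"
      using mc by (auto simp: markov_chain_def)
    have mass: "(\<Sum>i<d. pmf \<pi> i) = 1"
      using st by (intro sum_pmf_eq_1) (auto simp: stationary_def)
    show "measure_pmf.prob P ?good \<ge> 1 - \<delta>"
    proof (cases "d = 1")
      case True
      then have "min_prob d \<pi> = 1" using mass by (simp add: min_prob_def lessThan_Suc)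
      then have "?good = UNIV" using True \<epsilon> by (auto simp: est_def)
      then show ?thesis using \<delta> by simp
    next
      case False
      then have d2: "2 \<le> d" using d1 by simp
      interpret prob_weights d "pmf \<pi>"
        by unfold_locales (use ergodic_stationary_positive[OF rs erg st] mass in auto)
      have M: "kernel M" using rs st by (auto simp: kernel_def stationary_def)
      have rev: "time_reversal d \<pi> M = reversal M" by (simp add: time_reversal_def reversal_def)
      obtain k g where k: "1 \<le> k" and g: "0 < g" "g \<le> 1"
        and ps: "pseudo_spectral_gap d \<pi> M = g / real k"
        and gap: "\<And>f. ip f (\<lambda>_. 1) = 0 \<Longrightarrow>
           ip (app d (M ^\<^sub>m k) f) (app d (M ^\<^sub>m k) f) \<le> (1 - g) * ip f f"
        using pseudo_spectral_gap_attained[OF d2 M erg rev] by blast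
      define r where "r = min_prob d \<pi>"
      have ne: "pmf \<pi> ` {..<d} \<noteq> {}" using d2 by (auto simp: lessThan_empty_iff)
      have "r \<in> pmf \<pi> ` {..<d}" unfolding r_def min_prob_def using ne by (intro Min_in) auto
      then obtain i0 where i0: "i0 < d" "pmf \<pi> i0 = r" by auto
      have r: "0 < r" "r \<le> 1" using p_pos[OF i0(1)] p_le_1[OF i0(1)] i0(2) by auto
      have r_le: "r \<le> pmf \<pi> i" if "i < d" for i
        unfolding r_def min_prob_def using that by (intro Min_le) auto
      define L where "L = ln (real d / \<delta> * sqrt (inverse r))"
      have "1 < real d / \<delta>" using d2 \<delta> by (simp add: field_simps)
      moreover have "1 \<le> sqrt (inverse r)" using r by (simp add: one_le_inverse)
      ultimately have "1 < real d / \<delta> * sqrt (inverse r)" by (rule less_1_mult')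
      then have L: "0 < L" by (simp add: L_def)
      have mL: "256 / (g / real k * \<epsilon>\<^sup>2 * r) * L \<le> real m"
        using m unfolding ps r_def[symmetric] L_def .
      have den: "0 < g / real k * \<epsilon>\<^sup>2 * r" using g k \<epsilon> r by simp
      have "0 < 256 / (g / real k * \<epsilon>\<^sup>2 * r) * L" by (intro mult_pos_pos divide_pos_pos den L) simp
      then have m1: "1 \<le> m" using mL by simp
      define x where "x = real m * r * \<epsilon>\<^sup>2 * g / (64 * real k)"
      have x: "4 * L \<le> x"
      proof -
        have "256 * L \<le> real m * (g / real k * \<epsilon>\<^sup>2 * r)"
        proof -
          have "256 / D * L * D = 256 * L" if "D \<noteq> 0" for D :: real using that by simp
          moreover have "256 / (g / real k * \<epsilon>\<^sup>2 * r) * L * (g / real k * \<epsilon>\<^sup>2 * r)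
              \<le> real m * (g / real k * \<epsilon>\<^sup>2 * r)"
            using den by (intro mult_right_mono mL) simp
          ultimately show ?thesis using den by (metis less_irrefl)
        qed
        moreover have "x = real m * (g / real k * \<epsilon>\<^sup>2 * r) / 64" by (simp add: x_def mult_ac)
        moreover have "4 * L \<le> x" if "256 * L \<le> E" "x = E / 64" for E using that by linarith
        ultimately show ?thesis by blast
      qed
      \<comment> \<open>Lower deviations matter at every state, upper ones only at a minimizer \<open>i0\<close>.\<close>
      define T where "T \<sigma> i = {xs \<in> paths d m. \<sigma> * (real (count_list xs i) - real m * pmf \<pi> i)
          \<ge> \<epsilon> * (real m * pmf \<pi> i)}" for \<sigma> :: real and i
      have tail: "measure_pmf.prob P (T \<sigma> i) \<le> exp (1 / 2 - x) / r"
        if "i < d" "\<sigma> = 1 \<or> \<sigma> = - 1" for \<sigma> i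
        unfolding T_def x_def
        by (rule occupation_tail_any_start[OF M d2 that(1) m1 k g \<epsilon> that(2) gap \<mu> P r(1) r_le])
      define U where "U = (\<Union>i<d. T (- 1) i) \<union> T 1 i0"
      have good: "xs \<in> ?good" if xs: "xs \<in> paths d m" "xs \<notin> U" for xs
      proof -
        have m0: "0 < real m" using m1 by simp
        have lo: "(1 - \<epsilon>) * pmf \<pi> i < real (count_list xs i) / real m" if "i \<in> {..<d}" for i
        proof -
          have "xs \<notin> T (- 1) i" using xs that by (auto simp: U_def)
          then show ?thesis using xs(1) m0 by (simp add: T_def field_simps)
        qed
        have hi: "real (count_list xs i0) / real m < (1 + \<epsilon>) * pmf \<pi> i0"
        proof -
          have "xs \<notin> T 1 i0" using xs by (auto simp: U_def)
          then show ?thesis using xs(1) m0 by (simp add: T_def field_simps)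
        qed
        have "\<bar>Min ((\<lambda>i. real (count_list xs i) / real m) ` {..<d}) - Min (pmf \<pi> ` {..<d})\<bar>
            < \<epsilon> * Min (pmf \<pi> ` {..<d})"
        proof (rule Min_relative_error)
          show "(1 - \<epsilon>) * pmf \<pi> i < real (count_list xs i) / real m" if "i \<in> {..<d}" for i
            by (rule lo[OF that])
          show "real (count_list xs i0) / real m < (1 + \<epsilon>) * pmf \<pi> i0" by (rule hi)
          show "pmf \<pi> i0 = Min (pmf \<pi> ` {..<d})" using i0(2) by (simp add: r_def min_prob_def)
        qed (use \<epsilon> ne i0(1) in auto)
        then show ?thesis using False by (simp add: est_def min_prob_def)
      qed
      have "measure_pmf.prob P U \<le> (\<Sum>i<d. measure_pmf.prob P (T (- 1) i)) + measure_pmf.prob P (T 1 i0)"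
        unfolding U_def
        by (intro order_trans[OF measure_Un_le] add_right_mono measure_UNION_le) auto
      also have "\<dots> \<le> (\<Sum>i<d. exp (1 / 2 - x) / r) + exp (1 / 2 - x) / r"
        using tail i0(1) by (intro add_mono sum_mono) auto
      also have "\<dots> = (real d + 1) * (exp (1 / 2 - x) / r)"
        by (simp add: distrib_right add_divide_distrib)
      also have "\<dots> \<le> \<delta>"
        using x by (intro union_bound_arith[OF d2 r \<delta>]) (simp add: L_def)
      finally have U: "measure_pmf.prob P U \<le> \<delta>" .
      have "1 = measure_pmf.prob P (paths d m)" using trajectory_law_paths(2)[OF M \<mu> m1 P] by simp
      also have "\<dots> \<le> measure_pmf.prob P (?good \<union> U)"
        using good by (intro measure_pmf.finite_measure_mono) auto
      also have "\<dots> \<le> measure_pmf.prob P ?good + measure_pmf.prob P U"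
        by (intro measure_Un_le) auto
      finally show ?thesis using U by linarith
    qed
  qed
qed simp

end
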